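(* Consider the Monster (Semple) tower $\cdots\to M^k\to M^{k-1}\to\cdots\to M^1\to M^0=\mathbb R^3$ with base $\mathbb R^3$ and $\Delta^0=T\mathbb R^3$. Let $k\ge 1$ and let $\omega=\omega_1\omega_2\cdots\omega_k$ be a word of length $k$ in the alphabet $\{R,V,T_1,T_2,L_1,L_2,L_3\}$. Then there exists a point $p\in M^k$ with RVT code $\omega$ if and only if $\omega$ satisfies all of the following rules: \begin{enumerate} \item $\omega_1=R$; \item for $1\le i<k$, if $\omega_i=R$ then $\omega_{i+1}\in\{R,V\}$; \item for $1\le i<k$, if $\omega_i\in\{V,T_1\}$ then $\omega_{i+1}\in\{R,V,T_1,L_1\}$; \item for $1\le i<k$, if $\omega_i=T_2$ then $\omega_{i+1}\in\{R,V,T_2,L_3\}$; \item for $1\le i<k$, if $\omega_i\in\{L_1,L_2,L_3\}$ then $\omega_{i+1}$ may be any of the seven letters (no restriction). \end{enumerate}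
   Context: **Prolongation and the tower.** Given a smooth manifold $M$ with a rank $r$ distribution $\Delta\subset TM$, its (Cartan) prolongation is the manifold $\bigcup_{p\in M}\mathbb P\Delta_p$, whose points are pairs $(p,l)$ with $p\in M$ and $l$ a line (one-dimensional linear subspace) in $\Delta_p$, equipped with the rank $r$ distribution whose value at $(p,l)$ is $(d\pi)^{-1}(l)$, where $\pi(p,l)=p$. The tower with base $\mathbb R^3$ is obtained by starting with $M^0=\mathbb R^3$, $\Delta^0=T\mathbb R^3$ and letting $(M^i,\Delta^i)$ be the prolongation of $(M^{i-1},\Delta^{i-1})$. Thus $\dim M^i=3+2i$, $\Delta^i$ has rank $3$, and the fibers of $\pi^i_{i-1}:M^i\to M^{i-1}$ are copies of $\mathbb{RP}^2$. Compositions of these projections are denoted $\pi^k_i:M^k\to M^i$ ($i<k$). For $p_k\in M^k$ write $p_i=\pi^k_i(p_k)$ for $i<k$. **Baby Monsters and critical planes.** For $i\ge 1$ and $p_i\in M^i$, let $F_i(p_i)=(\pi^i_{i-1})^{-1}(p_{i-1})\subset M^i$ be the fiber through $p_i$. It is a $2$-dimensional integral submanifold of $\Delta^i$. Prolonging the pair $(F_i(p_i),TF_i(p_i))$ $j$ times ($j\ge 0$) gives a pair $(F_i^j(p_i),\delta_i^j)$, where $F_i^j(p_i)$ is a submanifold of $M^{i+j}$ of dimension $2+j$ and $\delta_i^j(q)=\Delta^{i+j}(q)\cap T_qF_i^j(p_i)$ is a $2$-plane for each $q\in F_i^j(p_i)$. This tower is called a Baby Monster born at level $i$. For $q\in M^k$,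 the critical planes in $\Delta^k(q)$ are the planes $\delta_i^{k-i}(q)$ for those $1\le i\le k$ such that $q\in F_i^{k-i}(p_i)$, where $p_i=\pi^k_i(q)$ (and $p_k=q$). There are no critical planes in $\Delta^0$. **Kumpera–Ruiz (KR) coordinates.** Coordinates $(x,y,z,u_1,v_1,\dots,u_k,v_k)$ near a point $p_k\in M^k$ are constructed inductively, with $\pi^k_i$ being the map that forgets $u_{i+1},v_{i+1},\dots,u_k,v_k$. At level $0$, the coordinates on $\mathbb R^3$ are $x,y,z$. Writing $p_1=(p_0,l_0)$, one may permute $x,y,z$ so that $dx|_{l_0}\ne 0$, and sets $u_1=dy/dx$, $v_1=dz/dx$, $f_1=x$. For $i\ge1$, the restriction of $(df_i,du_i,dv_i)$ is a coframe of $\Delta^i$ near $p_i$, and lines $l\subset\Delta^i$ have homogeneous coordinates $[df_i:du_i:dv_i]$. Writing $p_{i+1}=(p_i,l_i)$, divide by the first (left-most) of $df_i,du_i,dv_i$ that does not vanish on $l_i$. The two remaining ratios, in left-to-right order, are $u_{i+1},v_{i+1}$, and $f_{i+1}$ is the coordinate whose differential one divided by. (E.g. if $df_i|_{l_i}\neq0$: $u_{i+1}=du_i/df_i$, $v_{i+1}=dv_i/df_i$, $f_{i+1}=f_i$; if $df_i|_{l_i}=0\ne du_i|_{l_i}$: $u_{i+1}=df_i/du_i$, $v_{i+1}=dv_i/du_i$, $f_{i+1}=u_i$; if $df_i|_{l_i}=du_i|_{l_i}=0$: $u_{i+1}=df_i/dv_i$, $v_{i+1}=du_i/dv_i$, $f_{i+1}=v_i$.)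 **The planes $V,T_1,T_2$ and lines $L_1,L_2,L_3$.** Let $q\in M^i$, $i\ge1$. Let $(x,y,z,u_1,v_1,\dots,u_i,v_i)$ be the KR coordinates near $q$, and $f_i$ the associated coordinate function, obtained by the inductive construction of dividing, at each level $j<i$ (with $j\ge 1$), by the left-most of $df_j,du_j,dv_j$ not vanishing on the line $l_j$, where $\pi^i_{j+1}(q)=(\pi^i_j(q),l_j)$ (with $\pi^i_i(q)=q$), starting from $u_1=dy/dx$, $v_1=dz/dx$, $f_1=x$; thus $(df_i,du_i,dv_i)$ restricts to a coframe of $\Delta^i$ near $q$. - The vertical plane $V(q)$ is the critical plane $\delta_i^0(q)=T_qF_i(q)=\operatorname{span}\{\partial/\partial u_i,\partial/\partial v_i\}$. It is given in $\Delta^i(q)$ by $df_i=0$. - $T_1(q)$ is the critical plane in $\Delta^i(q)$ other than $V(q)$ that contains $\partial/\partial v_i$, if such a critical plane exists (it is then unique). It is given in $\Delta^i(q)$ by $du_i=0$, i.e. projectively by $[df_i:du_i:dv_i]=[a:0:b]$. - $T_2(q)$ is the critical plane in $\Delta^i(q)$ that does not contain $\partial/\partial v_i$, if such a critical plane exists (it is then unique). It is given in $\Delta^i(q)$ by $dv_i=0$, i.e. projectively by $[df_i:du_i:dv_i]=[a:b:0]$. - $L_1(q)=V(q)\cap T_1(q)$, $L_2(q)=T_1(q)\cap T_2(q)$, $L_3(q)=V(q)\cap T_2(q)$, each defined only when both planes involved exist as critical planes in $\Delta^i(q)$. **RVT code.** A point $p_{i+1}=(p_i,l_i)\in M^{i+1}$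 is assigned a letter as follows. If $l_i=L_j(p_i)$ for some $j\in\{1,2,3\}$ (with $L_j(p_i)$ defined), the letter is $L_j$. Otherwise, if $l_i$ is contained in one of the critical planes $V(p_i)$, $T_1(p_i)$, $T_2(p_i)$ that exists in $\Delta^i(p_i)$, the letter is $V$, $T_1$, $T_2$ respectively. Otherwise the letter is $R$. Since $\Delta^0$ contains no critical planes, every point of $M^1$ has letter $R$. The RVT code of $p\in M^k$ is the word $\omega_1\omega_2\cdots\omega_k$ where $\omega_i$ is the letter assigned to $\pi^k_i(p)$ for $i<k$, and $\omega_k$ is the letter assigned to $p$. *)

theory Defs
  imports "HOL-Analysis.Analysis" "HOL-Analysis.Finite_Function_Topology"
begin

section \<open>The ambient space\<close>

text \<open>
  The manifolds \<open>M\<^sup>i\<close> of the tower have different dimensions.  All of them are realised as embedded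
  submanifolds of finite-dimensional coordinate subspaces of the one normed space \<open>ambient\<close> of
  finitely supported real families.  A pair \<open>(p, l)\<close>, with \<open>p\<close> in the ambient space and \<open>l\<close> a line in
  it, is encoded by storing the coordinates of \<open>p\<close> at the indices \<open>Old a\<close>, and the matrix of the
  orthogonal projector onto \<open>l\<close> at the indices \<open>Entry a b\<close>.  This is the standard embedding of
  projective space by \<open>[v] \<mapsto> v v\<^sup>T / |v|\<^sup>2\<close>, so the encoding carries the manifold structure
  of a projectivised vector bundle.  \<open>Coord 0\<close>, \<open>Coord 1\<close>, \<open>Coord 2\<close> index the coordinates of \<open>\<real>\<^sup>3\<close>.
\<close>

datatype index = Coord nat | Old index | Entry index index

type_synonym ambient = "index \<Rightarrow>\<^sub>0 real"

definition is_line :: "ambient set \<Rightarrow> bool" where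
  "is_line l \<longleftrightarrow> subspace l \<and> dim l = 1"

definition projector :: "ambient set \<Rightarrow> index \<Rightarrow> index \<Rightarrow> real" where
  "projector l a b =
     (let v = (SOME v. v \<in> l \<and> v \<noteq> 0)
      in Poly_Mapping.lookup v a * Poly_Mapping.lookup v b
         / (\<Sum>c\<in>Poly_Mapping.keys v. (Poly_Mapping.lookup v c)\<^sup>2))"

definition point :: "ambient \<Rightarrow> ambient set \<Rightarrow> ambient" where
  "point p l = Abs_poly_mapping
     (\<lambda>i. case i of Coord n \<Rightarrow> 0 | Old a \<Rightarrow> Poly_Mapping.lookup p a | Entry a b \<Rightarrow> projector l a b)"

text \<open>
  \<open>base\<close> is the bundle projection \<open>\<pi>(p, l) = p\<close>.  It is the restriction of a linear map of the
  ambient space, so its differential is given by \<open>base\<close> as well.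
\<close>

definition base :: "ambient \<Rightarrow> ambient" where
  "base q = Poly_Mapping.map_key Old q"

definition line :: "ambient \<Rightarrow> ambient set" where
  "line q = (THE l. is_line l \<and> (\<exists>p. q = point p l))"

lemma lookup_base: "Poly_Mapping.lookup (base q) a = Poly_Mapping.lookup q (Old a)"
  by (simp add: base_def map_key.rep_eq inj_def)

lemma is_line_span:
  assumes "is_line l" "v \<in> l" "v \<noteq> 0"
  shows "l = span {v}"
proof -
  from assms(1) obtain B where B: "B \<subseteq> l" "independent B" "l \<subseteq> span B" "card B = 1"
    unfolding is_line_def by (metis basis_exists)
  from \<open>card B = 1\<close> obtain b where b: "B = {b}"
    by (auto simp: card_1_singleton_iff)
  with B(3) assms(2) obtain c where c: "v = c *\<^sub>R b"
    by (auto simp: span_singleton)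
  with assms(3) have "c \<noteq> 0" by auto
  with c have "b = (1 / c) *\<^sub>R v" by simp
  then have "b \<in> span {v}"
    by (metis span_base span_scale singletonI)
  then have "span B \<subseteq> span {v}"
    by (simp add: b span_minimal)
  with B(3) have "l \<subseteq> span {v}" by blast
  moreover have "span {v} \<subseteq> l"
    using assms(1,2) by (simp add: is_line_def span_minimal)
  ultimately show ?thesis by blast
qed

lemma is_line_nonzero:
  assumes "is_line l"
  obtains v where "v \<in> l" "v \<noteq> 0"
proof -
  have "\<not> l \<subseteq> {0}"
  proof
    assume "l \<subseteq> {0}"
    then have "dim l = 0"
      using dim_unique[of "{}" l 0] by (auto simp: independent_empty)
    with assms show False by (simp add: is_line_def)
  qed
  then show ?thesis using that by auto
qed

lemma sum_squares_scaleR: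
  assumes "c \<noteq> 0"
  shows "(\<Sum>i\<in>Poly_Mapping.keys (c *\<^sub>R v). (Poly_Mapping.lookup (c *\<^sub>R v) i)\<^sup>2)
       = c\<^sup>2 * (\<Sum>i\<in>Poly_Mapping.keys (v :: ambient). (Poly_Mapping.lookup v i)\<^sup>2)"
proof -
  have l: "Poly_Mapping.lookup (c *\<^sub>R v) i = c * Poly_Mapping.lookup v i" for i
    by (simp add: scaleR_poly_mapping_def)
  have "Poly_Mapping.keys (c *\<^sub>R v) = Poly_Mapping.keys v"
    using assms by (auto simp: in_keys_iff l)
  then show ?thesis
    by (simp add: l power_mult_distrib sum_distrib_left)
qed

lemma projector_eq:
  assumes "is_line l" "v \<in> l" "v \<noteq> 0"
  shows "projector l a b = Poly_Mapping.lookup v a * Poly_Mapping.lookup v b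
           / (\<Sum>c\<in>Poly_Mapping.keys v. (Poly_Mapping.lookup v c)\<^sup>2)"
proof -
  define w where "w = (SOME v. v \<in> l \<and> v \<noteq> 0)"
  have w: "w \<in> l" "w \<noteq> 0"
    using someI[of "\<lambda>v. v \<in> l \<and> v \<noteq> 0" v] assms by (auto simp: w_def)
  then obtain c where c: "w = c *\<^sub>R v"
    using is_line_span[OF assms] by (auto simp: span_singleton)
  with w have c0: "c \<noteq> 0" by auto
  have "Poly_Mapping.lookup w i = c * Poly_Mapping.lookup v i" for i
    by (simp add: c scaleR_poly_mapping_def)
  moreover have "(\<Sum>i\<in>Poly_Mapping.keys w. (Poly_Mapping.lookup w i)\<^sup>2)
       = c\<^sup>2 * (\<Sum>i\<in>Poly_Mapping.keys v. (Poly_Mapping.lookup v i)\<^sup>2)"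
    unfolding c by (rule sum_squares_scaleR[OF c0])
  ultimately show ?thesis
    using c0 by (simp add: projector_def w_def[symmetric] power2_eq_square)
qed

lemma lookup_point:
  assumes "is_line l"
  shows "Poly_Mapping.lookup (point p l) i =
    (case i of Coord n \<Rightarrow> 0 | Old a \<Rightarrow> Poly_Mapping.lookup p a | Entry a b \<Rightarrow> projector l a b)"
proof -
  obtain v where v: "v \<in> l" "v \<noteq> 0" using is_line_nonzero[OF assms] .
  let ?f = "\<lambda>i. case i of Coord n \<Rightarrow> 0 | Old a \<Rightarrow> Poly_Mapping.lookup p a | Entry a b \<Rightarrow> projector l a b"
  have "{i. ?f i \<noteq> 0} \<subseteq> Old ` Poly_Mapping.keys p
          \<union> (\<lambda>(a, b). Entry a b) ` (Poly_Mapping.keys v \<times> Poly_Mapping.keys v)"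
  proof
    fix i assume "i \<in> {i. ?f i \<noteq> 0}"
    then show "i \<in> Old ` Poly_Mapping.keys p
          \<union> (\<lambda>(a, b). Entry a b) ` (Poly_Mapping.keys v \<times> Poly_Mapping.keys v)"
      by (cases i) (auto simp: in_keys_iff projector_eq[OF assms v])
  qed
  then have "finite {i. ?f i \<noteq> 0}"
    by (rule finite_subset) auto
  then show ?thesis
    by (simp add: point_def)
qed

lemma base_point:
  assumes "is_line l"
  shows "base (point p l) = p"
  by (rule poly_mapping_eqI) (simp add: lookup_base lookup_point[OF assms])

lemma point_inject_line:
  assumes l: "is_line l" and l': "is_line l'" and eq: "point p l = point p' l'"
  shows "l = l'"
proof -
  obtain v where v: "v \<in> l" "v \<noteq> 0" using is_line_nonzero[OF l] .
  obtain w where w: "w \<in> l'" "w \<noteq> 0" using is_line_nonzero[OF l'] .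
  define V where "V = (\<Sum>c\<in>Poly_Mapping.keys v. (Poly_Mapping.lookup v c)\<^sup>2)"
  define W where "W = (\<Sum>c\<in>Poly_Mapping.keys w. (Poly_Mapping.lookup w c)\<^sup>2)"
  have pr: "projector l a b = projector l' a b" for a b
    using lookup_point[OF l, of p "Entry a b"] lookup_point[OF l', of p' "Entry a b"] eq by simp
  obtain b where b: "Poly_Mapping.lookup v b \<noteq> 0"
    using v(2) by (metis lookup_zero poly_mapping_eqI)
  then have "b \<in> Poly_Mapping.keys v" by (simp add: in_keys_iff)
  then have "V > 0"
    unfolding V_def using b by (intro sum_pos2[where i = b]) auto
  define k where "k = V * Poly_Mapping.lookup w b / (W * Poly_Mapping.lookup v b)"
  have "Poly_Mapping.lookup v a = k * Poly_Mapping.lookup w a" for a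
    using pr[of a b] b \<open>V > 0\<close>
    unfolding k_def projector_eq[OF l v] projector_eq[OF l' w] V_def[symmetric] W_def[symmetric]
    by (cases "W = 0") (auto simp: field_simps)
  then have "v = k *\<^sub>R w"
    by (intro poly_mapping_eqI) (simp add: scaleR_poly_mapping_def)
  moreover have "k *\<^sub>R w \<in> l'"
    using l' w by (auto simp: is_line_def intro: subspace_scale)
  ultimately have "v \<in> l'" by simp
  then show ?thesis
    using is_line_span[OF l v] is_line_span[OF l' _ v(2)] by simp
qed

lemma line_point:
  assumes "is_line l"
  shows "line (point p l) = l"
  unfolding line_def using assms point_inject_line by (intro the_equality) blast+

section \<open>Tangent vectors and differentials\<close>

definition smooth_curve :: "real set \<Rightarrow> (real \<Rightarrow> ambient) \<Rightarrow> bool" where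
  "smooth_curve I \<gamma> \<longleftrightarrow>
     (\<exists>g. g 0 = \<gamma> \<and> (\<forall>n. \<forall>t\<in>I. (g n has_vector_derivative g (Suc n) t) (at t)))"

definition curve_with_velocity ::
    "ambient set \<Rightarrow> ambient \<Rightarrow> ambient \<Rightarrow> (real \<Rightarrow> ambient) \<Rightarrow> bool" where
  "curve_with_velocity S p w \<gamma> \<longleftrightarrow>
     (\<exists>e>0. smooth_curve {-e<..<e} \<gamma> \<and> \<gamma> ` {-e<..<e} \<subseteq> S) \<and>
     \<gamma> 0 = p \<and> (\<gamma> has_vector_derivative w) (at 0)"

definition tangent :: "ambient set \<Rightarrow> ambient \<Rightarrow> ambient set" where
  "tangent S p = {w. \<exists>\<gamma>. curve_with_velocity S p w \<gamma>}"

text \<open>\<open>differential S f p w\<close> is \<open>df(w)\<close> for \<open>w \<in> T\<^sub>pS\<close> and \<open>f\<close> a function on \<open>S\<close>, smooth near \<open>p\<close>.\<close>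

definition differential ::
    "ambient set \<Rightarrow> (ambient \<Rightarrow> real) \<Rightarrow> ambient \<Rightarrow> ambient \<Rightarrow> real" where
  "differential S f p w =
     (THE d. \<exists>\<gamma>. curve_with_velocity S p w \<gamma> \<and> ((\<lambda>t. f (\<gamma> t)) has_real_derivative d) (at 0))"

definition coordinate_vector ::
    "ambient set \<Rightarrow> (ambient \<Rightarrow> real) list \<Rightarrow> nat \<Rightarrow> ambient \<Rightarrow> ambient" where
  "coordinate_vector S cs n q =
     (THE w. w \<in> tangent S q \<and>
        (\<forall>m<length cs. differential S (cs ! m) q w = (if m = n then 1 else 0)))"

section \<open>Prolongation and the tower\<close>

type_synonym distribution = "ambient set \<times> (ambient \<Rightarrow> ambient set)"

fun prolong :: "distribution \<Rightarrow> distribution" where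
  "prolong (S, D) =
     (let S' = {point p l |p l. p \<in> S \<and> is_line l \<and> l \<subseteq> D p}
      in (S', \<lambda>q. {w \<in> tangent S' q. base w \<in> line q}))"

definition R3 :: "ambient set" where
  "R3 = {p. Poly_Mapping.keys p \<subseteq> Coord ` {..<3}}"

definition tower :: "nat \<Rightarrow> distribution" where
  "tower i = (prolong ^^ i) (R3, tangent R3)"

abbreviation M :: "nat \<Rightarrow> ambient set" where
  "M i \<equiv> fst (tower i)"

abbreviation \<Delta> :: "nat \<Rightarrow> ambient \<Rightarrow> ambient set" where
  "\<Delta> i \<equiv> snd (tower i)"

section \<open>Baby Monsters and critical planes\<close>

definition fiber :: "nat \<Rightarrow> ambient \<Rightarrow> ambient set" where
  "fiber i p = {q \<in> M i. base q = base p}"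

definition baby_monster :: "nat \<Rightarrow> nat \<Rightarrow> ambient \<Rightarrow> distribution" where
  "baby_monster i j p = (prolong ^^ j) (fiber i p, tangent (fiber i p))"

definition critical_planes :: "nat \<Rightarrow> ambient \<Rightarrow> ambient set set" where
  "critical_planes k q =
     {snd (baby_monster i (k - i) ((base ^^ (k - i)) q)) q |i.
        1 \<le> i \<and> i \<le> k \<and> q \<in> fst (baby_monster i (k - i) ((base ^^ (k - i)) q))}"

section \<open>Kumpera--Ruiz coordinates\<close>

text \<open>For \<open>q = (p, l) \<in> M\<^sup>i\<^sup>+\<^sup>1\<close>: the differential \<open>dg\<close> of a function \<open>g\<close> on \<open>M\<^sup>i\<close> vanishes on \<open>l\<close>.\<close>

definition vanishes :: "nat \<Rightarrow> (ambient \<Rightarrow> real) \<Rightarrow> ambient \<Rightarrow> bool" where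
  "vanishes i g q \<longleftrightarrow> (\<forall>w\<in>line q. differential (M i) g (base q) w = 0)"

text \<open>The function \<open>dg/dh\<close> on \<open>M\<^sup>i\<^sup>+\<^sup>1\<close>, for functions \<open>g\<close>, \<open>h\<close> on \<open>M\<^sup>i\<close>.\<close>

definition ratio :: "nat \<Rightarrow> (ambient \<Rightarrow> real) \<Rightarrow> (ambient \<Rightarrow> real) \<Rightarrow> ambient \<Rightarrow> real" where
  "ratio i g h q =
     (let w = (SOME w. w \<in> line q \<and> w \<noteq> 0)
      in differential (M i) g (base q) w / differential (M i) h (base q) w)"

text \<open>
  \<open>kr s i q\<close> is the pair of the function \<open>f\<^sub>i\<close> and the list \<open>[x, y, z, u\<^sub>1, v\<^sub>1, \<dots>, u\<^sub>i, v\<^sub>i]\<close>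
  belonging to the point \<open>q \<in> M\<^sup>i\<close>, as functions on \<open>M\<^sup>i\<close> (meaningful near \<open>q\<close> only).  The
  permutation \<open>s\<close> says which of the three coordinates of \<open>\<real>\<^sup>3\<close> are called \<open>x\<close>, \<open>y\<close>, \<open>z\<close>.  With
  \<open>f\<^sub>0 = x\<close>, \<open>u\<^sub>0 = y\<close>, \<open>v\<^sub>0 = z\<close> and \<open>dx \<noteq> 0\<close> on the first line (\<open>admissible\<close> below), the general
  rule also covers the step from level \<open>0\<close> to level \<open>1\<close>.
\<close>

definition xyz :: "(nat \<Rightarrow> nat) \<Rightarrow> nat \<Rightarrow> ambient \<Rightarrow> real" where
  "xyz s j p = Poly_Mapping.lookup p (Coord (s j))"

fun kr :: "(nat \<Rightarrow> nat) \<Rightarrow> nat \<Rightarrow> ambient \<Rightarrow> (ambient \<Rightarrow> real) \<times> (ambient \<Rightarrow> real) list" where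
  "kr s 0 q = (xyz s 0, [xyz s 0, xyz s 1, xyz s 2])"
| "kr s (Suc i) q =
     (let (f, cs) = kr s i (base q);
          u = cs ! (2 * i + 1);
          v = cs ! (2 * i + 2);
          (h, a, b) = (if \<not> vanishes i f q then (f, u, v)
                       else if \<not> vanishes i u q then (u, f, v)
                       else (v, f, u))
      in (h \<circ> base, map (\<lambda>c. c \<circ> base) cs @ [ratio i a h, ratio i b h]))"

definition admissible :: "(nat \<Rightarrow> nat) \<Rightarrow> ambient \<Rightarrow> bool" where
  "admissible s q \<longleftrightarrow> s permutes {..<3} \<and> \<not> vanishes 0 (xyz s 0) q"

text \<open>The coordinate vector \<open>\<partial>/\<partial>v\<^sub>i\<close> at \<open>q \<in> M\<^sup>i\<close>; the coordinate \<open>v\<^sub>i\<close> has position \<open>2i + 2\<close>.\<close>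

definition dv :: "(nat \<Rightarrow> nat) \<Rightarrow> nat \<Rightarrow> ambient \<Rightarrow> ambient" where
  "dv s i q = coordinate_vector (M i) (snd (kr s i q)) (2 * i + 2) q"

section \<open>The planes \<open>V\<close>, \<open>T\<^sub>1\<close>, \<open>T\<^sub>2\<close>, the lines \<open>L\<^sub>1\<close>, \<open>L\<^sub>2\<close>, \<open>L\<^sub>3\<close>, and the RVT code\<close>

text \<open>
  These planes and lines need not exist.  Each is given as a set with at most one element, which is
  empty if the plane or line does not exist.
\<close>

definition V_plane :: "nat \<Rightarrow> ambient \<Rightarrow> ambient set set" where
  "V_plane i q = {P \<in> critical_planes i q. P = snd (baby_monster i 0 q) q}"

definition T1_plane :: "(nat \<Rightarrow> nat) \<Rightarrow> nat \<Rightarrow> ambient \<Rightarrow> ambient set set" where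
  "T1_plane s i q = {P \<in> critical_planes i q. P \<notin> V_plane i q \<and> dv s i q \<in> P}"

definition T2_plane :: "(nat \<Rightarrow> nat) \<Rightarrow> nat \<Rightarrow> ambient \<Rightarrow> ambient set set" where
  "T2_plane s i q = {P \<in> critical_planes i q. dv s i q \<notin> P}"

definition L1_line :: "(nat \<Rightarrow> nat) \<Rightarrow> nat \<Rightarrow> ambient \<Rightarrow> ambient set set" where
  "L1_line s i q = {P \<inter> Q |P Q. P \<in> V_plane i q \<and> Q \<in> T1_plane s i q}"

definition L2_line :: "(nat \<Rightarrow> nat) \<Rightarrow> nat \<Rightarrow> ambient \<Rightarrow> ambient set set" where
  "L2_line s i q = {P \<inter> Q |P Q. P \<in> T1_plane s i q \<and> Q \<in> T2_plane s i q}"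

definition L3_line :: "(nat \<Rightarrow> nat) \<Rightarrow> nat \<Rightarrow> ambient \<Rightarrow> ambient set set" where
  "L3_line s i q = {P \<inter> Q |P Q. P \<in> V_plane i q \<and> Q \<in> T2_plane s i q}"

datatype letter = R | V | T1 | T2 | L1 | L2 | L3

text \<open>The letter of the point \<open>(p, l) \<in> M\<^sup>i\<^sup>+\<^sup>1\<close>, where \<open>p \<in> M\<^sup>i\<close> and \<open>l \<subseteq> \<Delta>\<^sup>i(p)\<close>.\<close>

definition letter_of :: "(nat \<Rightarrow> nat) \<Rightarrow> nat \<Rightarrow> ambient \<Rightarrow> ambient set \<Rightarrow> letter" where
  "letter_of s i p l =
     (if l \<in> L1_line s i p then L1
      else if l \<in> L2_line s i p then L2
      else if l \<in> L3_line s i p then L3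
      else if \<exists>P\<in>V_plane i p. l \<subseteq> P then V
      else if \<exists>P\<in>T1_plane s i p. l \<subseteq> P then T1
      else if \<exists>P\<in>T2_plane s i p. l \<subseteq> P then T2
      else R)"

text \<open>
  The word \<open>\<omega>\<^sub>1 \<dots> \<omega>\<^sub>k\<close> of \<open>p \<in> M\<^sup>k\<close>.  The function \<open>\<sigma>\<close> selects, for every point of \<open>M\<^sup>1\<close>, the
  permutation of the coordinates of \<open>\<real>\<^sup>3\<close> used for the KR coordinates over that point.
\<close>

definition rvt_code :: "(ambient \<Rightarrow> nat \<Rightarrow> nat) \<Rightarrow> nat \<Rightarrow> ambient \<Rightarrow> letter list" where
  "rvt_code \<sigma> k p =
     map (\<lambda>i. let q = (base ^^ (k - i)) p
              in letter_of (\<sigma> ((base ^^ (k - 1)) p)) (i - 1) (base q) (line q))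
       [1..<Suc k]"

end

theory Submission
  imports Defs
begin

text \<open>
  Near a point \<open>q \<in> M\<^sup>i\<close> the Kumpera--Ruiz coordinates give a chart in which \<open>\<Delta>\<^sup>i\<close> is spanned by a vector
  field \<open>X\<close> with \<open>df\<^sub>i(X) = 1\<close> and the two coordinate fields of \<open>u\<^sub>i\<close>, \<open>v\<^sub>i\<close>.  So each of the three slots
  \<open>0, 1, 2\<close> (for \<open>f\<^sub>i, u\<^sub>i, v\<^sub>i\<close>) names a plane in \<open>\<Delta>\<^sup>i(q)\<close>, the kernel of the corresponding differential,
  and a line in \<open>\<Delta>\<^sup>i(q)\<close> has homogeneous coordinates \<open>[r\<^sub>0 : r\<^sub>1 : r\<^sub>2]\<close>.  The next coordinates are the
  ratios of the \<open>r\<close>'s to the leading nonzero one, \<open>r\<^sub>b\<close>, and the next frame is the lift of the line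
  together with the two new coordinate fields.

  In these charts every Baby Monster is a coordinate slice and its plane field is one of the three slot
  planes.  A newborn monster has slot \<open>0\<close>.  A monster with slot \<open>\<kappa>\<close> passes through the next
  point exactly if the chosen line has \<open>r\<^sub>\<kappa> = 0\<close>; then \<open>\<kappa> \<noteq> b\<close>, and the new coordinate
  \<open>r\<^sub>\<kappa> / r\<^sub>b\<close> vanishes along the prolonged monster, so that its new slot is \<open>1\<close> or \<open>2\<close>
  according to whether \<open>\<kappa>\<close> is the first or the second slot other than \<open>b\<close>
  (\<open>slice_fiber\<close>, \<open>slice_prolong\<close>, collected in \<open>kr_chart_prolong\<close>).

  Hence the set \<open>K\<close> of slots that carry critical planes determines which letters are possible, and \<open>K\<close>
  together with the chosen line determines the set for the next point.  This is a finite automaton: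
  after \<open>R\<close> the set is \<open>{0}\<close>, after \<open>V\<close> or \<open>T\<^sub>1\<close> it is \<open>{0, 1}\<close>, after \<open>T\<^sub>2\<close> it is \<open>{0, 2}\<close> and after any
  \<open>L\<^sub>j\<close> it is \<open>{0, 1, 2}\<close> (\<open>next_slots_eq\<close>).  The letters available for these sets are those of
  the spelling rules, and each of them is realised by a line whose coordinates are \<open>0\<close> or \<open>1\<close>
  (\<open>direction_realises\<close>).

  Smoothness is handled algebraically.  Parametrisations of the charts and coordinate functions
  are rational functions, a class closed under composition and differentiation; this yields the
  chain rule and a supply of smooth curves.
\<close>

section \<open>Rational functions and their derivatives\<close>

text \<open>
  The denominators have to be nonzero on \<open>A\<close> only: a coordinate function of the tower is a quotient whose
  denominator vanishes outside the domain of its chart.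
\<close>

inductive rational_on :: "('v \<Rightarrow> real) set \<Rightarrow> (('v \<Rightarrow> real) \<Rightarrow> real) \<Rightarrow> bool"
  for A :: "('v \<Rightarrow> real) set" where
  const: "rational_on A (\<lambda>x. c)"
| var: "rational_on A (\<lambda>x. x v)"
| add: "rational_on A f \<Longrightarrow> rational_on A g \<Longrightarrow> rational_on A (\<lambda>x. f x + g x)"
| mult: "rational_on A f \<Longrightarrow> rational_on A g \<Longrightarrow> rational_on A (\<lambda>x. f x * g x)"
| inverse: "rational_on A f \<Longrightarrow> (\<And>x. x \<in> A \<Longrightarrow> f x \<noteq> 0) \<Longrightarrow> rational_on A (\<lambda>x. inverse (f x))"

lemma rational_on_divide:
  assumes "rational_on A f" "rational_on A g" "\<And>x. x \<in> A \<Longrightarrow> g x \<noteq> 0"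
  shows "rational_on A (\<lambda>x. f x / g x)"
  unfolding divide_inverse by (intro rational_on.intros assms)

lemma rational_on_if:
  assumes "P \<Longrightarrow> rational_on A f" "\<not> P \<Longrightarrow> rational_on A g"
  shows "rational_on A (\<lambda>x. if P then f x else g x)"
  using assms by (cases P) auto

lemma rational_on_sum:
  assumes "\<And>i. i \<in> I \<Longrightarrow> rational_on A (f i)"
  shows "rational_on A (\<lambda>x. \<Sum>i\<in>I. f i x)"
  using assms
proof (induction I rule: infinite_finite_induct)
  case (insert i I)
  then have "rational_on A (\<lambda>x. f i x + (\<Sum>i\<in>I. f i x))" by (intro rational_on.add) auto
  with insert show ?case by simp
qed (auto intro: rational_on.const)

lemma rational_on_compose:
  assumes "rational_on A f" "\<And>v. rational_on B (h v)" "\<And>y. y \<in> B \<Longrightarrow> (\<lambda>v. h v y) \<in> A"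
  shows "rational_on B (\<lambda>y. f (\<lambda>v. h v y))"
  using assms by (induction) (auto intro: rational_on.intros)

lemma rational_on_subset: "rational_on A f \<Longrightarrow> B \<subseteq> A \<Longrightarrow> rational_on B f"
  by (induction rule: rational_on.induct) (auto intro: rational_on.intros)

text \<open>
  The differential is a single function \<open>d\<close> of the point (indices \<open>Inl\<close>) and the velocity (indices
  \<open>Inr\<close>), so that it can be required to be rational in both.  Derivatives of rational functions can
  then be composed and differentiated again.
\<close>

definition is_differential_on ::
    "('v \<Rightarrow> real) set \<Rightarrow> (('v \<Rightarrow> real) \<Rightarrow> real) \<Rightarrow> (('v + 'v \<Rightarrow> real) \<Rightarrow> real) \<Rightarrow> bool" where
  "is_differential_on A f d \<longleftrightarrow>
     rational_on {z. (\<lambda>v. z (Inl v)) \<in> A} d \<and>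
     (\<forall>x a b r t. d (case_sum x (\<lambda>v. r * a v + t * b v)) = r * d (case_sum x a) + t * d (case_sum x b)) \<and>
     (\<forall>c a t. (\<forall>v. ((\<lambda>t. c t v) has_real_derivative a v) (at t)) \<longrightarrow> c t \<in> A \<longrightarrow>
        ((\<lambda>t. f (c t)) has_real_derivative d (case_sum (c t) a)) (at t))"

lemma rational_on_has_differential:
  assumes "rational_on A f"
  shows "\<exists>d. is_differential_on A f d"
  using assms
proof induction
  case (const c)
  have "is_differential_on A (\<lambda>x. c) (\<lambda>z. 0)"
    unfolding is_differential_on_def by (auto intro: rational_on.intros)
  then show ?case by blast
next
  case (var v)
  have "is_differential_on A (\<lambda>x. x v) (\<lambda>z. z (Inr v))"
    unfolding is_differential_on_def by (auto intro: rational_on.intros)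
  then show ?case by blast
next
  case (add f g)
  then obtain d d' where d: "is_differential_on A f d" "is_differential_on A g d'" by blast
  have "is_differential_on A (\<lambda>x. f x + g x) (\<lambda>z. d z + d' z)"
    using d unfolding is_differential_on_def
    by (auto intro: rational_on.add intro!: DERIV_add simp: distrib_left)
  then show ?case by blast
next
  case (mult f g)
  then obtain d d' where d: "is_differential_on A f d" "is_differential_on A g d'" by blast
  have r: "rational_on {z. (\<lambda>v. z (Inl v)) \<in> A} (\<lambda>z. f (\<lambda>v. z (Inl v)))"
    "rational_on {z. (\<lambda>v. z (Inl v)) \<in> A} (\<lambda>z. g (\<lambda>v. z (Inl v)))"
    by (rule rational_on_compose[OF mult(1)] rational_on_compose[OF mult(2)];
        auto intro: rational_on.intros)+
  have "is_differential_on A (\<lambda>x. f x * g x)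
          (\<lambda>z. d z * g (\<lambda>v. z (Inl v)) + d' z * f (\<lambda>v. z (Inl v)))"
    unfolding is_differential_on_def
  proof (intro conjI allI impI, goal_cases)
    case 1
    show ?case using d r unfolding is_differential_on_def by (intro rational_on.intros) auto
  next
    case (2 x a b r t)
    show ?case using d unfolding is_differential_on_def by (simp add: algebra_simps)
  next
    case (3 c a t)
    then show ?case
      using d unfolding is_differential_on_def by (auto intro!: DERIV_mult)
  qed
  then show ?case by blast
next
  case (inverse f)
  then obtain d where d: "is_differential_on A f d" by blast
  have r: "rational_on {z. (\<lambda>v. z (Inl v)) \<in> A} (\<lambda>z. inverse (f (\<lambda>v. z (Inl v))))"
    using inverse(2)
    by (intro rational_on.inverse rational_on_compose[OF inverse(1)]) (auto intro: rational_on.intros)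
  have "is_differential_on A (\<lambda>x. inverse (f x))
          (\<lambda>z. - 1 * (inverse (f (\<lambda>v. z (Inl v))) * d z * inverse (f (\<lambda>v. z (Inl v)))))"
    unfolding is_differential_on_def
  proof (intro conjI allI impI, goal_cases)
    case 1
    from d have "rational_on {z. (\<lambda>v. z (Inl v)) \<in> A} d" by (simp add: is_differential_on_def)
    from rational_on.mult[OF rational_on.const rational_on.mult[OF rational_on.mult[OF r this] r]]
    show ?case .
  next
    case (2 x a b r t)
    show ?case using d unfolding is_differential_on_def by (simp add: algebra_simps)
  next
    case (3 c a t)
    then show ?case
      using d inverse(2)[of "c t"] DERIV_inverse'[of "\<lambda>t. f (c t)" "d (case_sum (c t) a)" t UNIV]
      unfolding is_differential_on_def by auto
  qed
  then show ?case by blast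
qed

definition derivative_on ::
    "('v \<Rightarrow> real) set \<Rightarrow> (('v \<Rightarrow> real) \<Rightarrow> real) \<Rightarrow> ('v \<Rightarrow> real) \<Rightarrow> ('v \<Rightarrow> real) \<Rightarrow> real" where
  "derivative_on A f x a = (SOME d. is_differential_on A f d) (case_sum x a)"

lemma derivative_on_chain:
  assumes "rational_on A f" "\<And>v. ((\<lambda>t. c t v) has_real_derivative a v) (at t)" "c t \<in> A"
  shows "((\<lambda>t. f (c t)) has_real_derivative derivative_on A f (c t) a) (at t)"
  using someI_ex[OF rational_on_has_differential[OF assms(1)]] assms(2,3)
  unfolding is_differential_on_def derivative_on_def by blast

lemma derivative_on_linear:
  assumes "rational_on A f"
  shows "derivative_on A f x (\<lambda>v. r * a v + t * b v)
       = r * derivative_on A f x a + t * derivative_on A f x b"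
  using someI_ex[OF rational_on_has_differential[OF assms(1)]]
  unfolding is_differential_on_def derivative_on_def by blast

lemma derivative_on_scale:
  assumes "rational_on A f"
  shows "derivative_on A f x (\<lambda>v. r * a v) = r * derivative_on A f x a"
  using derivative_on_linear[OF assms, of x r a 0 a] by simp

lemma rational_on_derivative:
  assumes "rational_on A f" "\<And>v. rational_on B (h v)" "\<And>v. rational_on B (k v)"
    and "\<And>y. y \<in> B \<Longrightarrow> (\<lambda>v. h v y) \<in> A"
  shows "rational_on B (\<lambda>y. derivative_on A f (\<lambda>v. h v y) (\<lambda>v. k v y))"
proof -
  define d where "d = (SOME d. is_differential_on A f d)"
  have d: "rational_on {z. (\<lambda>v. z (Inl v)) \<in> A} d"
    using someI_ex[OF rational_on_has_differential[OF assms(1)]]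
    unfolding is_differential_on_def d_def by blast
  have "rational_on B (\<lambda>y. d (\<lambda>s. (case s of Inl v \<Rightarrow> h v | Inr v \<Rightarrow> k v) y))"
    by (rule rational_on_compose[OF d]) (auto simp: assms split: sum.split)
  moreover have "(\<lambda>s. (case s of Inl v \<Rightarrow> h v | Inr v \<Rightarrow> k v) y) = case_sum (\<lambda>v. h v y) (\<lambda>v. k v y)" for y
    by (auto split: sum.split)
  ultimately show ?thesis
    by (simp add: derivative_on_def d_def)
qed

lemma rational_on_curve_continuous:
  assumes "rational_on A f" "\<And>v. ((\<lambda>t. c t v) has_real_derivative a v) (at t)" "c t \<in> A"
  shows "isCont (\<lambda>t. f (c t)) t"
  using derivative_on_chain[OF assms] by (rule DERIV_isCont)

text \<open>
  Differentiating along a line of fixed velocity \<open>a\<close> maps rational functions to rational functions, so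
  the iterates of this operation are the higher derivatives.
\<close>

lemma rational_on_affine_curve_smooth:
  assumes "rational_on UNIV f"
  shows "\<exists>h. h 0 = (\<lambda>t. f (\<lambda>v. x v + t * a v)) \<and>
    (\<forall>n t. (h n has_real_derivative h (Suc n) t) (at t))"
proof -
  define F where "F n = ((\<lambda>g x. derivative_on UNIV g x a) ^^ n) f" for n
  have rat: "rational_on UNIV (F n)" for n
  proof (induction n)
    case (Suc n)
    have "rational_on UNIV (\<lambda>y. derivative_on UNIV (F n) (\<lambda>v. y v) (\<lambda>v. a v))"
      by (rule rational_on_derivative[OF Suc]) (auto intro: rational_on.intros)
    then show ?case by (simp add: F_def)
  qed (simp add: F_def assms)
  have "((\<lambda>t. F n (\<lambda>v. x v + t * a v)) has_real_derivative F (Suc n) (\<lambda>v. x v + t * a v)) (at t)" for n t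
  proof -
    have "((\<lambda>t. F n (\<lambda>v. x v + t * a v)) has_real_derivative
             derivative_on UNIV (F n) (\<lambda>v. x v + t * a v) a) (at t)"
      by (rule derivative_on_chain[OF rat, where c = "\<lambda>t v. x v + t * a v"])
        (auto intro!: derivative_eq_intros)
    then show ?thesis by (simp add: F_def)
  qed
  then show ?thesis
    by (intro exI[of _ "\<lambda>n t. F n (\<lambda>v. x v + t * a v)"]) (simp add: F_def)
qed

section \<open>Curves in the ambient space\<close>

abbreviation lookup where "lookup \<equiv> Poly_Mapping.lookup"
abbreviation keys where "keys \<equiv> Poly_Mapping.keys"

lemma lookup_scaleR [simp]: "lookup (r *\<^sub>R (x :: ambient)) e = r * lookup x e"
  by (simp add: scaleR_poly_mapping_def)

lemma bounded_linear_lookup: "bounded_linear (\<lambda>x :: ambient. lookup x e)"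
proof (rule bounded_linear_intro[where K = 1])
  fix x :: ambient
  show "norm (lookup x e) \<le> norm x * 1"
  proof (cases "e \<in> keys x")
    case True
    then have "\<bar>lookup x e\<bar> \<le> (\<Sum>n\<in>keys x. \<bar>lookup x n\<bar>)"
      by (intro member_le_sum) auto
    then show ?thesis by (simp add: norm_poly_mapping_def dist_poly_mapping_def)
  qed (simp add: in_keys_iff)
qed (auto simp: lookup_add)

lemma lookup_vector_derivative:
  assumes "((\<gamma> :: real \<Rightarrow> ambient) has_vector_derivative w) (at t)"
  shows "((\<lambda>t. lookup (\<gamma> t) e) has_real_derivative lookup w e) (at t)"
  using bounded_linear.has_vector_derivative[OF bounded_linear_lookup assms]
  by (simp add: has_real_derivative_iff_has_vector_derivative)

lemma lookup_single_sum:
  assumes "finite (I :: index set)"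
  shows "lookup (\<Sum>e\<in>I. g e *\<^sub>R Poly_Mapping.single e (1::real)) a = (if a \<in> I then g a else 0)"
  using assms by (simp add: lookup_sum lookup_single when_def if_distrib cong: if_cong)

lemma ambient_expand:
  assumes "finite I" "keys (x :: ambient) \<subseteq> I"
  shows "x = (\<Sum>e\<in>I. lookup x e *\<^sub>R Poly_Mapping.single e 1)"
  using assms by (intro poly_mapping_eqI) (auto simp: lookup_single_sum in_keys_iff)

text \<open>
  A common finite support of the values of the curve turns the ambient space into a finite-dimensional
  one, where componentwise differentiability suffices.
\<close>

lemma vector_derivative_by_components:
  fixes \<gamma> :: "real \<Rightarrow> ambient"
  assumes I: "finite I" "\<And>t. keys (\<gamma> t) \<subseteq> I"
    and d: "\<And>e. ((\<lambda>t. lookup (\<gamma> t) e) has_real_derivative d e) (at t)"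
  shows "(\<gamma> has_vector_derivative (\<Sum>e\<in>I. d e *\<^sub>R Poly_Mapping.single e 1)) (at t)"
proof -
  have "\<gamma> = (\<lambda>t. \<Sum>e\<in>I. lookup (\<gamma> t) e *\<^sub>R Poly_Mapping.single e 1)"
    using ambient_expand[OF I] by blast
  moreover have "((\<lambda>t. \<Sum>e\<in>I. lookup (\<gamma> t) e *\<^sub>R (Poly_Mapping.single e 1 :: ambient)) has_vector_derivative
      (\<Sum>e\<in>I. d e *\<^sub>R Poly_Mapping.single e 1)) (at t)"
    by (intro has_vector_derivative_sum)
       (use has_vector_derivative_scaleR[OF d has_vector_derivative_const] in auto)
  ultimately show ?thesis by simp
qed

lemma smooth_by_components:
  fixes \<gamma> :: "real \<Rightarrow> ambient"
  assumes I: "finite I" "\<And>t. keys (\<gamma> t) \<subseteq> I"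
    and h: "\<And>e. \<exists>h. h 0 = (\<lambda>t. lookup (\<gamma> t) e) \<and> (\<forall>n t. (h n has_real_derivative h (Suc n) t) (at t))"
  shows "smooth_curve T \<gamma>"
proof -
  obtain h where h: "\<And>e. h e 0 = (\<lambda>t. lookup (\<gamma> t) e)"
    "\<And>e n t. (h e n has_real_derivative h e (Suc n) t) (at t)"
    using h by metis
  define g where "g n t = (\<Sum>e\<in>I. h e n t *\<^sub>R (Poly_Mapping.single e 1 :: ambient))" for n t
  have "g 0 = \<gamma>"
    using ambient_expand[OF I] by (auto simp: g_def h(1))
  moreover have "(g n has_vector_derivative g (Suc n) t) (at t)" for n t
    unfolding g_def
    by (intro has_vector_derivative_sum)
       (use has_vector_derivative_scaleR[OF h(2) has_vector_derivative_const] in auto)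
  ultimately show ?thesis unfolding smooth_curve_def by blast
qed

lemma is_line_span_singleton: "(v :: ambient) \<noteq> 0 \<Longrightarrow> is_line (span {v})"
  by (simp add: is_line_def dim_eq_card_independent)

lemma lookup_base_fun [simp]: "lookup (base q) = (\<lambda>e. lookup q (Old e))"
  by (simp add: fun_eq_iff lookup_base)

section \<open>Charts\<close>

text \<open>
  The map \<open>\<phi>\<close> parametrises the part of \<open>S\<close> that lies over \<open>D\<close> by all of \<open>\<real>\<^sup>N\<close>, with coordinate functions
  \<open>\<xi> 0, \<dots>, \<xi> (N - 1)\<close>.  Coordinate vectors are sequences of which the entries from \<open>N\<close> on are ignored;
  this keeps one type for all levels of the tower.  Openness of the domain is
  asked for along differentiable curves, which is what tangent vectors test.
\<close>

locale chart =
  fixes S :: "ambient set" and N :: nat and \<phi> :: "(nat \<Rightarrow> real) \<Rightarrow> ambient"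
    and \<xi> :: "nat \<Rightarrow> (index \<Rightarrow> real) \<Rightarrow> real" and D :: "(index \<Rightarrow> real) set"
  assumes rational_\<phi>: "\<And>e. rational_on UNIV (\<lambda>y. lookup (\<phi> y) e)"
    and finite_support: "finite (\<Union>y. keys (\<phi> y))"
    and \<phi>_cong: "\<And>y y'. (\<And>n. n < N \<Longrightarrow> y n = y' n) \<Longrightarrow> \<phi> y = \<phi> y'"
    and \<phi>_in: "\<And>y. \<phi> y \<in> S"
    and \<phi>_dom: "\<And>y. lookup (\<phi> y) \<in> D"
    and \<xi>_\<phi>: "\<And>n y. n < N \<Longrightarrow> \<xi> n (lookup (\<phi> y)) = y n"
    and \<phi>_\<xi>: "\<And>q. q \<in> S \<Longrightarrow> lookup q \<in> D \<Longrightarrow> \<phi> (\<lambda>n. \<xi> n (lookup q)) = q"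
    and rational_\<xi>: "\<And>n. rational_on D (\<xi> n)"
    and open_D: "\<And>c a. (\<And>e. ((\<lambda>t. c t e) has_real_derivative a e) (at 0)) \<Longrightarrow> c 0 \<in> D \<Longrightarrow>
        eventually (\<lambda>t. c t \<in> D) (nhds (0::real))"
begin

lemma \<phi>_inject:
  assumes "\<phi> y = \<phi> y'" "n < N"
  shows "y n = y' n"
  using assms \<xi>_\<phi> by metis

definition push :: "(nat \<Rightarrow> real) \<Rightarrow> (nat \<Rightarrow> real) \<Rightarrow> ambient" where
  "push y a = vector_derivative (\<lambda>t. \<phi> (\<lambda>n. y n + t * a n)) (at 0)"

lemma push_curve:
  assumes "\<And>n. ((\<lambda>t. c t n) has_real_derivative a n) (at t)"
  shows "((\<lambda>t. \<phi> (c t)) has_vector_derivative push (c t) a) (at t)"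
proof -
  define v where "v y = (\<Sum>e\<in>(\<Union>y. keys (\<phi> y)). derivative_on UNIV (\<lambda>y. lookup (\<phi> y) e) y a *\<^sub>R
      (Poly_Mapping.single e 1 :: ambient))" for y
  have *: "((\<lambda>t. \<phi> (c t)) has_vector_derivative v (c t)) (at t)"
    if "\<And>n. ((\<lambda>t. c t n) has_real_derivative a n) (at t)" for c t
    unfolding v_def
    by (intro vector_derivative_by_components finite_support)
       (auto intro!: derivative_on_chain[OF rational_\<phi>] that)
  have "v y = push y a" for y
    unfolding push_def
  proof (rule vector_derivative_at[symmetric])
    have "((\<lambda>t. \<phi> (\<lambda>n. y n + t * a n)) has_vector_derivative v (\<lambda>n. y n + 0 * a n)) (at 0)"
      by (rule *) (auto intro!: derivative_eq_intros)
    then show "((\<lambda>t. \<phi> (\<lambda>n. y n + t * a n)) has_vector_derivative v y) (at 0)" by simp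
  qed
  with *[OF assms] show ?thesis by simp
qed

lemma push_affine: "((\<lambda>t. \<phi> (\<lambda>n. y n + t * a n)) has_vector_derivative push y a) (at 0)"
proof -
  have "((\<lambda>t. \<phi> (\<lambda>n. y n + t * a n)) has_vector_derivative push (\<lambda>n. y n + 0 * a n) a) (at 0)"
    by (rule push_curve) (auto intro!: derivative_eq_intros)
  then show ?thesis by simp
qed

lemma lookup_push: "lookup (push y a) e = derivative_on UNIV (\<lambda>y. lookup (\<phi> y) e) y a"
proof -
  have "((\<lambda>t. lookup (\<phi> (\<lambda>n. y n + t * a n)) e) has_real_derivative
           derivative_on UNIV (\<lambda>y. lookup (\<phi> y) e) (\<lambda>n. y n + 0 * a n) a) (at 0)"
    by (rule derivative_on_chain[OF rational_\<phi>]) (auto intro!: derivative_eq_intros)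
  with lookup_vector_derivative[OF push_affine] show ?thesis
    by (auto dest: DERIV_unique)
qed

lemma push_linear: "push y (\<lambda>n. r * a n + s * b n) = r *\<^sub>R push y a + s *\<^sub>R push y b"
  by (rule poly_mapping_eqI) (simp add: lookup_push lookup_add derivative_on_linear[OF rational_\<phi>])

lemma push_scale: "push y (\<lambda>n. r * a n) = r *\<^sub>R push y a"
  using push_linear[of y r a 0 a] by simp

lemma push_cong:
  assumes "\<And>n. n < N \<Longrightarrow> y n = y' n" "\<And>n. n < N \<Longrightarrow> a n = a' n"
  shows "push y a = push y' a'"
proof -
  have "\<phi> (\<lambda>n. y n + t * a n) = \<phi> (\<lambda>n. y' n + t * a' n)" for t
    by (rule \<phi>_cong) (simp add: assms)
  then show ?thesis by (simp add: push_def)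
qed

text \<open>
  Since \<open>\<xi>\<close> inverts \<open>\<phi>\<close>, its derivative is a left inverse of the derivative of \<open>\<phi>\<close>; in particular \<open>\<phi>\<close> is
  an immersion.
\<close>

lemma derivative_\<xi>_push:
  assumes "n < N"
  shows "derivative_on D (\<xi> n) (lookup (\<phi> y)) (lookup (push y a)) = a n"
proof -
  have "((\<lambda>t. \<xi> n (lookup (\<phi> (\<lambda>n. y n + t * a n)))) has_real_derivative
      derivative_on D (\<xi> n) (lookup (\<phi> (\<lambda>n. y n + 0 * a n))) (lookup (push y a))) (at 0)"
    by (rule derivative_on_chain[OF rational_\<xi>])
       (auto intro: lookup_vector_derivative push_affine \<phi>_dom)
  moreover have "((\<lambda>t. \<xi> n (lookup (\<phi> (\<lambda>n. y n + t * a n)))) has_real_derivative a n) (at 0)"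
    using assms by (auto simp: \<xi>_\<phi> intro!: derivative_eq_intros)
  ultimately show ?thesis by (auto dest: DERIV_unique)
qed

lemma push_inject:
  assumes "push y a = push y b" "n < N"
  shows "a n = b n"
  using derivative_\<xi>_push[OF assms(2)] assms(1) by metis

text \<open>
  A curve through a point of the chart stays in the chart for a short time, where it is the image of its
  own coordinate functions.  So all questions about tangent vectors can be settled in coordinates.
\<close>

lemma lift_curve:
  assumes \<gamma>: "curve_with_velocity F (\<phi> y) w \<gamma>" and F: "F \<subseteq> S"
  shows "\<exists>c a. (\<forall>n. ((\<lambda>t. c t n) has_real_derivative a n) (at 0)) \<and> w = push y a \<and>
    eventually (\<lambda>t. \<gamma> t \<in> F \<and> \<gamma> t = \<phi> (c t)) (nhds 0)"
proof -
  from \<gamma> obtain e where e: "e > 0" "\<gamma> ` {-e<..<e} \<subseteq> F"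
    and \<gamma>0: "\<gamma> 0 = \<phi> y" and v: "(\<gamma> has_vector_derivative w) (at 0)"
    unfolding curve_with_velocity_def by blast
  define c where "c t n = \<xi> n (lookup (\<gamma> t))" for t n
  define a where "a n = derivative_on D (\<xi> n) (lookup (\<gamma> 0)) (lookup w)" for n
  have a: "((\<lambda>t. c t n) has_real_derivative a n) (at 0)" for n
    unfolding c_def a_def
    by (rule derivative_on_chain[OF rational_\<xi>]) (auto intro: lookup_vector_derivative v simp: \<gamma>0 \<phi>_dom)
  have c0: "c 0 n = y n" if "n < N" for n
    using that by (simp add: c_def \<gamma>0 \<xi>_\<phi>)
  have "eventually (\<lambda>t. lookup (\<gamma> t) \<in> D) (nhds 0)"
    by (rule open_D[OF lookup_vector_derivative[OF v]]) (simp add: \<gamma>0 \<phi>_dom)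
  moreover have "eventually (\<lambda>t. \<gamma> t \<in> F) (nhds 0)"
    using eventually_nhds_in_open[of "{-e<..<e}" 0] e by (auto elim!: eventually_mono)
  ultimately have ev: "eventually (\<lambda>t. \<gamma> t \<in> F \<and> \<gamma> t = \<phi> (c t)) (nhds 0)"
  proof eventually_elim
    case (elim t)
    then show ?case using \<phi>_\<xi>[of "\<gamma> t"] F unfolding c_def by auto
  qed
  have "((\<lambda>t. \<phi> (c t)) has_vector_derivative push (c 0) a) (at 0)"
    by (rule push_curve[OF a])
  moreover have "((\<lambda>t. \<phi> (c t)) has_vector_derivative w) (at 0)"
  proof -
    have ev': "eventually (\<lambda>t. \<phi> (c t) = \<gamma> t) (nhds 0)"
      using ev by eventually_elim simp
    show ?thesis
      using v has_vector_derivative_cong_ev[of UNIV "\<lambda>t. \<phi> (c t)" \<gamma> 0 w]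
        ev' eventually_nhds_x_imp_x[OF ev'] by auto
  qed
  ultimately have "w = push (c 0) a"
    by (rule vector_derivative_unique_at[rotated])
  also have "\<dots> = push y a" by (rule push_cong) (auto simp: c0)
  finally show ?thesis using a ev by blast
qed

lemma affine_curve:
  assumes "\<And>t. \<phi> (\<lambda>n. y n + t * a n) \<in> F"
  shows "curve_with_velocity F (\<phi> y) (push y a) (\<lambda>t. \<phi> (\<lambda>n. y n + t * a n))"
proof -
  have "smooth_curve {-1<..<1} (\<lambda>t. \<phi> (\<lambda>n. y n + t * a n))"
    by (intro smooth_by_components[OF finite_support] rational_on_affine_curve_smooth rational_\<phi>) auto
  then show ?thesis
    unfolding curve_with_velocity_def using assms push_affine
    by (auto intro!: exI[of _ 1])
qed

text \<open>
  Along a curve in \<open>F\<close> the coordinates in \<open>Z\<close> are constant; conversely the affine curves with velocity \<open>0\<close>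
  in these coordinates stay in \<open>F\<close>.
\<close>

lemma tangent_slice:
  assumes F: "F \<subseteq> S" "\<And>y'. \<phi> y' \<in> F \<longleftrightarrow> (\<forall>n\<in>Z. y' n = y0 n)" and Z: "Z \<subseteq> {..<N}"
    and y: "\<phi> y \<in> F"
  shows "tangent F (\<phi> y) = {push y a |a. \<forall>n\<in>Z. a n = 0}"
proof (intro equalityI subsetI)
  fix w assume "w \<in> tangent F (\<phi> y)"
  then obtain \<gamma> where \<gamma>: "curve_with_velocity F (\<phi> y) w \<gamma>" by (auto simp: tangent_def)
  obtain c a where c: "\<And>n. ((\<lambda>t. c t n) has_real_derivative a n) (at 0)"
    "w = push y a" and ev: "eventually (\<lambda>t. \<gamma> t \<in> F \<and> \<gamma> t = \<phi> (c t)) (nhds 0)"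
    using lift_curve[OF \<gamma> F(1)] by blast
  have "a n = 0" if "n \<in> Z" for n
  proof -
    have "eventually (\<lambda>t. c t n = y0 n) (nhds 0)"
      using ev by eventually_elim (use F(2) that in auto)
    then have "((\<lambda>t. c t n) has_real_derivative 0) (at 0)"
      by (subst DERIV_cong_ev[where g = "\<lambda>_. y0 n", OF refl _ refl]) auto
    with c(1) show ?thesis by (auto dest: DERIV_unique)
  qed
  with c(2) show "w \<in> {push y a |a. \<forall>n\<in>Z. a n = 0}" by blast
next
  fix w assume "w \<in> {push y a |a. \<forall>n\<in>Z. a n = 0}"
  then obtain a where a: "w = push y a" "\<forall>n\<in>Z. a n = 0" by blast
  with y F(2) have "\<phi> (\<lambda>n. y n + t * a n) \<in> F" for t by auto
  from affine_curve[OF this] a(1) show "w \<in> tangent F (\<phi> y)" by (auto simp: tangent_def)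
qed

lemma tangent_chart: "tangent S (\<phi> y) = {push y a |a. True}"
  using tangent_slice[of S "{}" undefined y] \<phi>_in by auto

text \<open>
  The differential is the derivative along an unspecified curve with the given velocity; by \<open>lift_curve\<close> all such
  curves give the same derivative of a coordinate function.
\<close>

lemma differential_coordinate:
  assumes g: "\<And>y. g (\<phi> y) = y n" and n: "n < N"
  shows "differential S g (\<phi> y) (push y a) = a n"
  unfolding differential_def
proof (rule the_equality)
  have "((\<lambda>t. g (\<phi> (\<lambda>n. y n + t * a n))) has_real_derivative a n) (at 0)"
    by (auto simp: g intro!: derivative_eq_intros)
  then show "\<exists>\<gamma>. curve_with_velocity S (\<phi> y) (push y a) \<gamma> \<and> ((\<lambda>t. g (\<gamma> t)) has_real_derivative a n) (at 0)"
    using affine_curve[of y a S] \<phi>_in by blast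
next
  fix d
  assume "\<exists>\<gamma>. curve_with_velocity S (\<phi> y) (push y a) \<gamma> \<and> ((\<lambda>t. g (\<gamma> t)) has_real_derivative d) (at 0)"
  then obtain \<gamma> where \<gamma>: "curve_with_velocity S (\<phi> y) (push y a) \<gamma>"
    and d: "((\<lambda>t. g (\<gamma> t)) has_real_derivative d) (at 0)" by blast
  obtain c a' where c: "\<And>n. ((\<lambda>t. c t n) has_real_derivative a' n) (at 0)"
    "push y a = push y a'" and ev: "eventually (\<lambda>t. \<gamma> t \<in> S \<and> \<gamma> t = \<phi> (c t)) (nhds 0)"
    using lift_curve[OF \<gamma> subset_refl] by blast
  have "eventually (\<lambda>t. g (\<gamma> t) = c t n) (nhds 0)"
    using ev by eventually_elim (simp add: g)
  with d have "((\<lambda>t. c t n) has_real_derivative d) (at 0)"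
    by (subst (asm) DERIV_cong_ev[OF refl _ refl]) auto
  from DERIV_unique[OF this c(1)] have "d = a' n" .
  with push_inject[OF c(2) n] show "d = a n" by simp
qed

end

section \<open>Charts adapted to the distribution, and their prolongation\<close>

text \<open>
  The coordinate vector \<open>r\<^sub>0 x + r\<^sub>1 \<partial>\<^bsub>N-2\<^esub> + r\<^sub>2 \<partial>\<^bsub>N-1\<^esub>\<close>.  The last two of the \<open>N\<close> coordinates are \<open>u\<^sub>i\<close> and
  \<open>v\<^sub>i\<close>, and \<open>x\<close> will be the value of the vector field \<open>X\<close>.
\<close>

definition frame :: "nat \<Rightarrow> (nat \<Rightarrow> real) \<Rightarrow> (nat \<Rightarrow> real) \<Rightarrow> nat \<Rightarrow> real" where
  "frame N x r n = r 0 * x n + (if n = N - 2 then r 1 else 0) + (if n = N - 1 then r 2 else 0)"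

text \<open>
  The position of the coordinate \<open>f\<^sub>i\<close>, \<open>u\<^sub>i\<close> or \<open>v\<^sub>i\<close> whose differential reads off \<open>r\<^sub>\<kappa>\<close>, where \<open>f\<close> is the position
  of \<open>f\<^sub>i\<close>.
\<close>

definition slot :: "nat \<Rightarrow> nat \<Rightarrow> nat \<Rightarrow> nat" where
  "slot N f \<kappa> = (if \<kappa> = 0 then f else if \<kappa> = 1 then N - 2 else N - 1)"

text \<open>
  If one divides by the differential in slot \<open>b\<close>, the remaining two slots give the new coordinates
  \<open>u\<close> and \<open>v\<close>, in left-to-right order.
\<close>

definition fst_other :: "nat \<Rightarrow> nat" where "fst_other b = (if b = 0 then 1 else 0)"
definition snd_other :: "nat \<Rightarrow> nat" where "snd_other b = (if b = 2 then 1 else 2)"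

lemma lookup_point_span:
  assumes "v \<noteq> 0"
  shows "lookup (point p (span {v})) (Coord n) = 0"
    and "lookup (point p (span {v})) (Old e) = lookup p e"
    and "lookup (point p (span {v})) (Entry e e') = lookup v e * lookup v e' / (\<Sum>c\<in>keys v. (lookup v c)\<^sup>2)"
  by (simp_all add: lookup_point[OF is_line_span_singleton[OF assms]]
      projector_eq[OF is_line_span_singleton[OF assms] span_base assms])

lemma sum_squares_pos:
  assumes "(v :: ambient) \<noteq> 0"
  shows "(\<Sum>c\<in>keys v. (lookup v c)\<^sup>2) > 0"
proof -
  have "keys v \<noteq> {}" using assms by simp
  then show ?thesis by (intro sum_pos) (auto simp: in_keys_iff)
qed

lemma mem_prolong_iff:
  "q \<in> fst (prolong (S, D)) \<longleftrightarrow> (\<exists>p l. q = point p l \<and> p \<in> S \<and> is_line l \<and> l \<subseteq> D p)"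
  by (simp add: Let_def)

lemma point_mem_prolong_iff:
  assumes "is_line l"
  shows "point p l \<in> fst (prolong (S, D)) \<longleftrightarrow> p \<in> S \<and> l \<subseteq> D p"
  unfolding mem_prolong_iff using assms by (metis base_point line_point)

lemma snd_prolong:
  "snd (prolong (S, D)) q = {w \<in> tangent (fst (prolong (S, D))) q. base w \<in> line q}"
  by (simp add: Let_def)

text \<open>
  A chart in which the rank 3 distribution \<open>Del\<close> has the frame \<open>X\<close>, \<open>\<partial>\<^bsub>N-2\<^esub>\<close>, \<open>\<partial>\<^bsub>N-1\<^esub>\<close>, dual to the differentials of the
  coordinates \<open>f\<close>, \<open>N - 2\<close>, \<open>N - 1\<close>.
\<close>

locale framed_chart = chart S N \<phi> \<xi> D
  for S :: "ambient set" and N :: nat and \<phi> :: "(nat \<Rightarrow> real) \<Rightarrow> ambient"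
    and \<xi> :: "nat \<Rightarrow> (index \<Rightarrow> real) \<Rightarrow> real" and D :: "(index \<Rightarrow> real) set" +
  fixes Del :: "ambient \<Rightarrow> ambient set" and f :: nat and X :: "(nat \<Rightarrow> real) \<Rightarrow> nat \<Rightarrow> real"
  assumes f_less: "f + 2 < N"
    and rational_X: "\<And>n. rational_on UNIV (\<lambda>y. X y n)"
    and X_cong: "\<And>y y' n. (\<And>m. m < N \<Longrightarrow> y m = y' m) \<Longrightarrow> X y n = X y' n"
    and X_f: "\<And>y. X y f = 1"
    and X_last: "\<And>y n. N \<le> n + 2 \<Longrightarrow> X y n = 0"
    and Del: "\<And>y. Del (\<phi> y) = {push y (frame N (X y) r) |r. True}"
begin

abbreviation slt :: "nat \<Rightarrow> nat" where "slt \<equiv> slot N f"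

abbreviation vec :: "(nat \<Rightarrow> real) \<Rightarrow> (nat \<Rightarrow> real) \<Rightarrow> ambient" where
  "vec y r \<equiv> push y (frame N (X y) r)"

lemma slot_less: "slt \<kappa> < N"
  using f_less by (auto simp: slot_def)

lemma frame_slot:
  assumes "\<kappa> < 3"
  shows "frame N (X y) r (slt \<kappa>) = r \<kappa>"
proof -
  have "f \<noteq> N - 2" "f \<noteq> N - 1" using f_less by linarith+
  note ne = this
  from assms consider "\<kappa> = 0" | "\<kappa> = 1" | "\<kappa> = 2" by linarith
  then show ?thesis
    using f_less ne by cases (simp_all add: frame_def slot_def X_f X_last)
qed

lemma vec_inject:
  assumes "vec y r = vec y r'" "\<kappa> < 3"
  shows "r \<kappa> = r' \<kappa>"
  using push_inject[OF assms(1) slot_less[of \<kappa>]] assms(2) by (simp add: frame_slot)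

lemma vec_scale: "vec y (\<lambda>\<kappa>. t * r \<kappa>) = t *\<^sub>R vec y r"
proof -
  have "frame N (X y) (\<lambda>\<kappa>. t * r \<kappa>) = (\<lambda>n. t * frame N (X y) r n)"
    by (auto simp: frame_def algebra_simps fun_eq_iff)
  then show ?thesis by (simp add: push_scale)
qed

lemma vec_cong: "(\<And>\<kappa>. \<kappa> < 3 \<Longrightarrow> r \<kappa> = r' \<kappa>) \<Longrightarrow> vec y r = vec y r'"
  by (rule push_cong) (simp_all add: frame_def)

lemma vec_eq_0_iff: "vec y r = 0 \<longleftrightarrow> (\<forall>\<kappa><3. r \<kappa> = 0)"
proof -
  have 0: "vec y (\<lambda>\<kappa>. 0) = 0"
    using vec_scale[of y 0 "\<lambda>_. 0"] by simp
  show ?thesis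
  proof
    assume "vec y r = 0"
    then show "\<forall>\<kappa><3. r \<kappa> = 0" using vec_inject[of y r "\<lambda>_. 0"] 0 by auto
  next
    assume "\<forall>\<kappa><3. r \<kappa> = 0"
    then have "vec y r = vec y (\<lambda>\<kappa>. 0)" by (intro vec_cong) auto
    then show "vec y r = 0" by (simp only: 0)
  qed
qed

lemma push_mem_span_iff:
  "push y a \<in> span {push y a'} \<longleftrightarrow> (\<exists>k. \<forall>n<N. a n = k * a' n)"
proof
  assume "push y a \<in> span {push y a'}"
  then obtain k where "push y a = k *\<^sub>R push y a'" by (auto simp: span_singleton)
  then have "push y a = push y (\<lambda>n. k * a' n)" by (simp add: push_scale)
  then show "\<exists>k. \<forall>n<N. a n = k * a' n" using push_inject by blast
next
  assume "\<exists>k. \<forall>n<N. a n = k * a' n"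
  then obtain k where k: "\<And>n. n < N \<Longrightarrow> a n = k * a' n" by blast
  have "push y a = push y (\<lambda>n. k * a' n)" by (rule push_cong) (auto simp: k)
  then have "push y a = k *\<^sub>R push y a'" by (simp add: push_scale)
  then show "push y a \<in> span {push y a'}" by (auto simp: span_singleton)
qed

definition ratios :: "nat \<Rightarrow> (nat \<Rightarrow> real) \<Rightarrow> nat \<Rightarrow> real" where
  "ratios b y \<kappa> = (if \<kappa> = b then 1 else if \<kappa> = fst_other b then y N else y (Suc N))"

text \<open>
  The coordinates \<open>y\<close> of a point of the prolongation consist of the \<open>N\<close> coordinates of its base point
  and of two ratios, at \<open>N\<close> and \<open>N + 1\<close>.  The line is spanned by the vector with these coordinates,
  normalised to have entry \<open>1\<close> in slot \<open>b\<close>.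
\<close>

definition spanning :: "nat \<Rightarrow> (nat \<Rightarrow> real) \<Rightarrow> nat \<Rightarrow> real" where
  "spanning b y = frame N (X y) (ratios b y)"

definition prol_par :: "nat \<Rightarrow> (nat \<Rightarrow> real) \<Rightarrow> ambient" where
  "prol_par b y = point (\<phi> y) (span {push y (spanning b y)})"

text \<open>
  A line spanned by \<open>v\<close> is stored as the matrix \<open>v v\<^sup>T / |v|\<^sup>2\<close>.  Applying the differentials of two coordinates
  \<open>m\<close> and \<open>m'\<close> to its two indices gives \<open>d\<xi>\<^sub>m(v) d\<xi>\<^bsub>m'\<^esub>(v) / |v|\<^sup>2\<close>, and a quotient of two such numbers is the ratio
  of differentials that defines a new coordinate.  This exhibits the new coordinates as rational functions
  of the stored entries.
\<close>

definition contract :: "nat \<Rightarrow> nat \<Rightarrow> (index \<Rightarrow> real) \<Rightarrow> real" where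
  "contract m m' z = derivative_on D (\<xi> m) (\<lambda>e. z (Old e))
     (\<lambda>e'. derivative_on D (\<xi> m') (\<lambda>e. z (Old e)) (\<lambda>e. z (Entry e e')))"

definition prol_crd :: "nat \<Rightarrow> nat \<Rightarrow> (index \<Rightarrow> real) \<Rightarrow> real" where
  "prol_crd b n z = (if n < N then \<xi> n (\<lambda>e. z (Old e))
     else if n = N then contract (slt b) (slt (fst_other b)) z / contract (slt b) (slt b) z
     else if n = Suc N then contract (slt b) (slt (snd_other b)) z / contract (slt b) (slt b) z
     else 0)"

definition prol_dom :: "nat \<Rightarrow> (index \<Rightarrow> real) set" where
  "prol_dom b = {z. (\<lambda>e. z (Old e)) \<in> D \<and> contract (slt b) (slt b) z \<noteq> 0}"

definition prol_X :: "nat \<Rightarrow> (nat \<Rightarrow> real) \<Rightarrow> nat \<Rightarrow> real" where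
  "prol_X b y n = (if n < N then spanning b y n else 0)"

lemma spanning_slot: "\<kappa> < 3 \<Longrightarrow> spanning b y (slt \<kappa>) = ratios b y \<kappa>"
  by (simp add: spanning_def frame_slot)

lemma push_spanning_nonzero: "b < 3 \<Longrightarrow> push y (spanning b y) \<noteq> 0"
  unfolding spanning_def vec_eq_0_iff by (auto intro!: exI[of _ b] simp: ratios_def)

lemma rational_spanning: "rational_on UNIV (\<lambda>y. spanning b y n)"
  unfolding spanning_def frame_def ratios_def
  by (intro rational_on.add rational_on.mult rational_X rational_on_if rational_on.const rational_on.var)

lemma rational_push_spanning: "rational_on UNIV (\<lambda>y. lookup (push y (spanning b y)) e)"
  unfolding lookup_push
  by (rule rational_on_derivative[OF rational_\<phi>, where h = "\<lambda>v y. y v" and k = "\<lambda>v y. spanning b y v"])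
     (auto intro: rational_on.var rational_spanning)

text \<open>
  All vectors \<open>push y a\<close> share the support of the chart, so their squared norms are sums over one fixed
  finite index set and hence rational functions.
\<close>

lemma keys_push: "keys (push y a) \<subseteq> (\<Union>y. keys (\<phi> y))"
proof
  fix e assume e: "e \<in> keys (push y a)"
  show "e \<in> (\<Union>y. keys (\<phi> y))"
  proof (rule ccontr)
    assume "e \<notin> (\<Union>y. keys (\<phi> y))"
    then have "lookup (\<phi> y) e = 0" for y by (auto simp: in_keys_iff)
    then have "((\<lambda>t::real. 0) has_real_derivative lookup (push y a) e) (at 0)"
      using lookup_vector_derivative[OF push_affine[of y a], of e] by simp
    then have "lookup (push y a) e = 0" by (rule DERIV_unique) simp
    with e show False by (simp add: in_keys_iff)
  qed
qed

lemma contract_point: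
  assumes v: "push y a \<noteq> 0" and m: "m < N" "m' < N"
  shows "contract m m' (lookup (point (\<phi> y) (span {push y a})))
       = a m * a m' / (\<Sum>c\<in>keys (push y a). (lookup (push y a) c)\<^sup>2)"
proof -
  define Q where "Q = (\<Sum>c\<in>keys (push y a). (lookup (push y a) c)\<^sup>2)"
  have *: "(\<lambda>e. lookup (push y a) e * lookup (push y a) e' / Q)
      = (\<lambda>e. (lookup (push y a) e' / Q) * lookup (push y a) e)" for e'
    by (auto simp: fun_eq_iff)
  have **: "(\<lambda>e'. lookup (push y a) e' / Q * k) = (\<lambda>e'. (k / Q) * lookup (push y a) e')" for k
    by (auto simp: fun_eq_iff)
  show ?thesis
    unfolding contract_def lookup_point_span[OF v] Q_def[symmetric] * derivative_on_scale[OF rational_\<xi>]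
      derivative_\<xi>_push[OF m(1)] derivative_\<xi>_push[OF m(2)] **
    by simp
qed

lemma contract_prol_par:
  assumes b: "b < 3" and m: "m < N"
  shows "contract (slt b) m (lookup (prol_par b y)) =
    spanning b y m / (\<Sum>c\<in>keys (push y (spanning b y)). (lookup (push y (spanning b y)) c)\<^sup>2)"
  unfolding prol_par_def contract_point[OF push_spanning_nonzero[OF b] slot_less m] spanning_slot[OF b]
  by (simp add: ratios_def)

lemma rational_contract: "rational_on {z. (\<lambda>e. z (Old e)) \<in> D} (contract m m')"
  unfolding contract_def[abs_def]
proof (rule rational_on_derivative[OF rational_\<xi>, where h = "\<lambda>e z. z (Old e)"])
  show "rational_on {z. (\<lambda>e. z (Old e)) \<in> D}
      (\<lambda>z. derivative_on D (\<xi> m') (\<lambda>e. z (Old e)) (\<lambda>e. z (Entry e e')))" for e'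
    by (rule rational_on_derivative[OF rational_\<xi>, where h = "\<lambda>e z. z (Old e)" and k = "\<lambda>e z. z (Entry e e')"])
       (auto intro: rational_on.var)
qed (auto intro: rational_on.var)

lemma norm_spanning:
  "(\<Sum>c\<in>(\<Union>y. keys (\<phi> y)). (lookup (push y (spanning b y)) c)\<^sup>2) =
   (\<Sum>c\<in>keys (push y (spanning b y)). (lookup (push y (spanning b y)) c)\<^sup>2)"
  by (intro sum.mono_neutral_right finite_support keys_push) (simp add: in_keys_iff)

lemma lookup_prol_par:
  assumes "b < 3"
  shows "lookup (prol_par b y) (Coord n) = 0"
    and "lookup (prol_par b y) (Old e) = lookup (\<phi> y) e"
    and "lookup (prol_par b y) (Entry e e') = lookup (push y (spanning b y)) e * lookup (push y (spanning b y)) e' /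
       (\<Sum>c\<in>(\<Union>y. keys (\<phi> y)). (lookup (push y (spanning b y)) c)\<^sup>2)"
  unfolding norm_spanning prol_par_def
  by (rule lookup_point_span[OF push_spanning_nonzero[OF assms]])+

lemma spanning_cong:
  assumes "\<And>n. n < N + 2 \<Longrightarrow> y n = y' n"
  shows "spanning b y n = spanning b y' n"
  using X_cong[of y y'] assms by (simp add: spanning_def frame_def ratios_def)

lemma is_line_Del:
  assumes "is_line l" "l \<subseteq> Del (\<phi> y)"
  obtains r where "l = span {vec y r}" "vec y r \<noteq> 0"
proof -
  obtain v where v: "v \<in> l" "v \<noteq> 0" using is_line_nonzero[OF assms(1)] .
  with assms(2) obtain r where "v = vec y r" by (auto simp: Del)
  with v is_line_span[OF assms(1) v] that show ?thesis by metis
qed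

lemma span_vec_subset_Del: "span {vec y r} \<subseteq> Del (\<phi> y)"
proof
  fix w assume "w \<in> span {vec y r}"
  then obtain k where "w = vec y (\<lambda>\<kappa>. k * r \<kappa>)" by (auto simp: span_singleton vec_scale)
  then show "w \<in> Del (\<phi> y)" unfolding Del by blast
qed

lemma ratios_eq:
  assumes b: "b < 3" "r b \<noteq> 0" and y': "y' N = r (fst_other b) / r b" "y' (Suc N) = r (snd_other b) / r b"
    and \<kappa>: "\<kappa> < 3"
  shows "ratios b y' \<kappa> = r \<kappa> / r b"
proof (cases "\<kappa> = b \<or> \<kappa> = fst_other b")
  case False
  with \<kappa> b(1) have "\<kappa> = snd_other b" by (auto simp: fst_other_def snd_other_def split: if_splits)
  with False show ?thesis using y'(2) by (simp add: ratios_def)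
qed (use b(2) y'(1) in \<open>auto simp: ratios_def\<close>)

text \<open>
  Homogeneous coordinates \<open>r\<close> of a line with \<open>r b \<noteq> 0\<close> give its coordinates in the \<open>b\<close>-th chart of
  the prolongation by division.
\<close>

lemma prol_par_eq:
  assumes b: "b < 3" "r b \<noteq> 0" and y': "\<And>n. n < N \<Longrightarrow> y' n = y n"
    "y' N = r (fst_other b) / r b" "y' (Suc N) = r (snd_other b) / r b"
  shows "prol_par b y' = point (\<phi> y) (span {vec y r})"
proof -
  have "ratios b y' \<kappa> = (1 / r b) * r \<kappa>" if "\<kappa> < 3" for \<kappa>
    using ratios_eq[OF b y'(2,3) that] by simp
  then have "push y' (spanning b y') = vec y (\<lambda>\<kappa>. (1 / r b) * r \<kappa>)"
    unfolding spanning_def using X_cong[of y' y] y'(1)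
    by (intro push_cong) (auto simp: frame_def)
  then have "push y' (spanning b y') = (1 / r b) *\<^sub>R vec y r" by (simp only: vec_scale)
  moreover have "span {k *\<^sub>R v} = span {v}" if "k \<noteq> 0" for k and v :: ambient
  proof (rule span_eq[THEN iffD2], intro conjI)
    have "v = (1 / k) *\<^sub>R k *\<^sub>R v" using that by simp
    then show "{v} \<subseteq> span {k *\<^sub>R v}" unfolding span_singleton by blast
    show "{k *\<^sub>R v} \<subseteq> span {v}" unfolding span_singleton by blast
  qed
  moreover have "\<phi> y' = \<phi> y" using y'(1) by (rule \<phi>_cong)
  ultimately show ?thesis using b(2) by (simp add: prol_par_def)
qed

theorem chart_prolong:
  assumes b: "b < 3"
  shows "chart (fst (prolong (S, Del))) (N + 2) (prol_par b) (prol_crd b) (prol_dom b)"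
proof
  fix e show "rational_on UNIV (\<lambda>y. lookup (prol_par b y) e)"
  proof (cases e)
    case (Entry e e')
    have "(\<Sum>c\<in>(\<Union>y. keys (\<phi> y)). (lookup (push y (spanning b y)) c)\<^sup>2) \<noteq> 0" for y
      unfolding norm_spanning using sum_squares_pos[OF push_spanning_nonzero[OF b, of y]] by simp
    then show ?thesis
      unfolding Entry lookup_prol_par[OF b] power2_eq_square
      by (intro rational_on_divide rational_on.mult rational_on_sum rational_push_spanning)
  qed (simp_all add: lookup_prol_par[OF b] rational_\<phi> rational_on.const)
next
  define I where "I = (\<Union>y. keys (\<phi> y))"
  have "keys (prol_par b y) \<subseteq> Old ` I \<union> (\<lambda>(e, e'). Entry e e') ` (I \<times> I)" for y
  proof
    fix e assume e: "e \<in> keys (prol_par b y)"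
    then show "e \<in> Old ` I \<union> (\<lambda>(e, e'). Entry e e') ` (I \<times> I)"
    proof (cases e)
      case (Entry e1 e2)
      with e have "e1 \<in> keys (push y (spanning b y))" "e2 \<in> keys (push y (spanning b y))"
        by (auto simp: in_keys_iff lookup_prol_par[OF b])
      then have "(e1, e2) \<in> I \<times> I" using keys_push unfolding I_def by blast
      then show ?thesis using Entry by (auto intro!: image_eqI[of _ _ "(e1, e2)"])
    next
      case (Old e1)
      with e have "e1 \<in> I" by (auto simp: in_keys_iff lookup_prol_par[OF b] I_def)
      then show ?thesis using Old by blast
    qed (simp add: in_keys_iff lookup_prol_par[OF b])
  qed
  then have "(\<Union>y. keys (prol_par b y)) \<subseteq> Old ` I \<union> (\<lambda>(e, e'). Entry e e') ` (I \<times> I)" by blast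
  moreover have "finite (Old ` I \<union> (\<lambda>(e, e'). Entry e e') ` (I \<times> I))"
    using finite_support by (simp add: I_def)
  ultimately show "finite (\<Union>y. keys (prol_par b y))" by (rule finite_subset)
next
  fix y y' :: "nat \<Rightarrow> real" assume y: "\<And>n. n < N + 2 \<Longrightarrow> y n = y' n"
  have "push y (spanning b y) = push y' (spanning b y')"
    by (rule push_cong) (auto simp: y intro: spanning_cong)
  moreover have "\<phi> y = \<phi> y'" by (rule \<phi>_cong) (auto simp: y)
  ultimately show "prol_par b y = prol_par b y'" by (simp add: prol_par_def)
next
  fix y
  show "prol_par b y \<in> fst (prolong (S, Del))"
    unfolding prol_par_def point_mem_prolong_iff[OF is_line_span_singleton[OF push_spanning_nonzero[OF b]]]
    using span_vec_subset_Del by (simp add: \<phi>_in spanning_def)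
  have Q: "(\<Sum>c\<in>keys (push y (spanning b y)). (lookup (push y (spanning b y)) c)\<^sup>2) > 0"
    by (rule sum_squares_pos[OF push_spanning_nonzero[OF b]])
  show "lookup (prol_par b y) \<in> prol_dom b"
    using Q b by (auto simp: prol_dom_def lookup_prol_par \<phi>_dom contract_prol_par slot_less spanning_slot ratios_def)
  fix n assume "n < N + 2"
  then consider "n < N" | "n = N" | "n = Suc N" by linarith
  then show "prol_crd b n (lookup (prol_par b y)) = y n"
    using Q b
    by cases (auto simp: prol_crd_def lookup_prol_par \<xi>_\<phi> contract_prol_par slot_less spanning_slot ratios_def
        fst_other_def snd_other_def)
next
  fix q assume q: "q \<in> fst (prolong (S, Del))" "lookup q \<in> prol_dom b"
  then obtain p l where pl: "q = point p l" "p \<in> S" "is_line l" "l \<subseteq> Del p"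
    unfolding mem_prolong_iff by blast
  have old: "(\<lambda>e. lookup q (Old e)) = lookup p" by (simp add: pl(1) lookup_point[OF pl(3)])
  define y where "y n = \<xi> n (lookup p)" for n
  have p: "p = \<phi> y"
    using \<phi>_\<xi>[of p] pl(2) q(2) old by (simp add: prol_dom_def y_def[abs_def])
  obtain r where r: "l = span {vec y r}" "vec y r \<noteq> 0"
    using is_line_Del[OF pl(3)] pl(4) p by blast
  have contract: "contract (slt b) (slt \<kappa>) (lookup q) = r b * r \<kappa> / (\<Sum>c\<in>keys (vec y r). (lookup (vec y r) c)\<^sup>2)"
    if "\<kappa> < 3" for \<kappa>
    using contract_point[OF r(2) slot_less slot_less] that b by (simp add: pl(1) r(1) p frame_slot)
  \<comment> \<open>the denominator in \<open>prol_dom b\<close> is \<open>(r b)\<^sup>2 / |v|\<^sup>2\<close> for the spanning vector \<open>v\<close>\<close>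
  have rb: "r b \<noteq> 0"
    using q(2) contract[OF b] by (auto simp: prol_dom_def)
  have "prol_par b (\<lambda>n. prol_crd b n (lookup q)) = point (\<phi> y) (span {vec y r})"
    using rb b contract sum_squares_pos[OF r(2)] old
    by (intro prol_par_eq) (auto simp: prol_crd_def y_def fst_other_def snd_other_def)
  then show "prol_par b (\<lambda>n. prol_crd b n (lookup q)) = q"
    using pl(1) r(1) p by simp
next
  fix n
  have "prol_dom b \<subseteq> {z. (\<lambda>e. z (Old e)) \<in> D}" by (auto simp: prol_dom_def)
  note contract = rational_on_subset[OF rational_contract this]
  have "rational_on (prol_dom b) (\<lambda>z. \<xi> n (\<lambda>e. z (Old e)))"
    by (rule rational_on_compose[OF rational_\<xi>]) (auto intro: rational_on.var simp: prol_dom_def)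
  moreover have "rational_on (prol_dom b) (\<lambda>z. contract (slt b) m z / contract (slt b) (slt b) z)" for m
    by (rule rational_on_divide[OF contract contract]) (auto simp: prol_dom_def)
  ultimately show "rational_on (prol_dom b) (prol_crd b n)"
    unfolding prol_crd_def[abs_def] by (intro rational_on_if rational_on.const)
next
  fix c :: "real \<Rightarrow> index \<Rightarrow> real" and a
  assume c: "\<And>e. ((\<lambda>t. c t e) has_real_derivative a e) (at 0)" "c 0 \<in> prol_dom b"
  have "eventually (\<lambda>t. (\<lambda>e. c t (Old e)) \<in> D) (nhds 0)"
    using open_D[of "\<lambda>t e. c t (Old e)" "\<lambda>e. a (Old e)"] c by (auto simp: prol_dom_def)
  moreover have "isCont (\<lambda>t. contract (slt b) (slt b) (c t)) 0"
    using rational_on_curve_continuous[OF rational_contract c(1)] c(2) by (auto simp: prol_dom_def)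
  then have "eventually (\<lambda>t. contract (slt b) (slt b) (c t) \<noteq> 0) (nhds 0)"
    using c(2) by (auto simp: isCont_def prol_dom_def eventually_nhds_conv_at intro: tendsto_imp_eventually_ne)
  ultimately show "eventually (\<lambda>t. c t \<in> prol_dom b) (nhds 0)"
    by eventually_elim (simp add: prol_dom_def)
qed

lemma line_prol_par: "b < 3 \<Longrightarrow> line (prol_par b y) = span {push y (spanning b y)}"
  by (simp add: prol_par_def line_point is_line_span_singleton push_spanning_nonzero)

lemma base_prol_par: "b < 3 \<Longrightarrow> base (prol_par b y) = \<phi> y"
  by (simp add: prol_par_def base_point is_line_span_singleton push_spanning_nonzero)

lemma base_push_prol_par:
  assumes b: "b < 3"
  shows "base (chart.push (prol_par b) y a) = push y a"
proof -
  interpret c': chart "fst (prolong (S, Del))" "N + 2" "prol_par b" "prol_crd b" "prol_dom b"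
    by (rule chart_prolong[OF b])
  show ?thesis
    by (rule poly_mapping_eqI) (simp add: c'.lookup_push lookup_push lookup_prol_par[OF b])
qed

lemma frame_prol_X: "n < N \<Longrightarrow> frame (N + 2) (prol_X b y) r n = r 0 * spanning b y n"
  by (auto simp: frame_def prol_X_def)

lemma frame_prol_X_last:
  "frame (N + 2) (prol_X b y) r N = r 1" "frame (N + 2) (prol_X b y) r (Suc N) = r 2"
  by (auto simp: frame_def prol_X_def)

text \<open>
  A tangent vector of the prolongation with coordinates \<open>a\<close> projects to the vector with the first \<open>N\<close> entries of
  \<open>a\<close>.  It belongs to the prolonged distribution exactly if these entries are proportional to the
  spanning vector of the line, while the last two entries are arbitrary.  So the spanning vector,
  extended by zeros, is the new field \<open>X\<close>.
\<close>

theorem framed_chart_prolong: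
  assumes b: "b < 3"
  shows "framed_chart (fst (prolong (S, Del))) (N + 2) (prol_par b) (prol_crd b) (prol_dom b)
     (snd (prolong (S, Del))) (slt b) (prol_X b)"
proof -
  interpret c': chart "fst (prolong (S, Del))" "N + 2" "prol_par b" "prol_crd b" "prol_dom b"
    by (rule chart_prolong[OF b])
  show ?thesis
  proof
    show "slt b + 2 < N + 2" using slot_less by simp
  next
    fix n show "rational_on UNIV (\<lambda>y. prol_X b y n)"
      unfolding prol_X_def by (intro rational_on_if rational_spanning rational_on.const)
  next
    fix y y' :: "nat \<Rightarrow> real" and n
    assume "\<And>m. m < N + 2 \<Longrightarrow> y m = y' m"
    then show "prol_X b y n = prol_X b y' n" using spanning_cong[of y y' b n] by (simp add: prol_X_def)
  next
    fix y show "prol_X b y (slt b) = 1"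
      using b by (simp add: prol_X_def slot_less spanning_slot ratios_def)
  next
    fix y n assume "N + 2 \<le> n + 2" then show "prol_X b y n = 0" by (simp add: prol_X_def)
  next
    fix y
    show "snd (prolong (S, Del)) (prol_par b y) = {c'.push y (frame (N + 2) (prol_X b y) r) |r. True}"
    proof (intro equalityI subsetI)
      fix w assume "w \<in> snd (prolong (S, Del)) (prol_par b y)"
      then have "w \<in> tangent (fst (prolong (S, Del))) (prol_par b y)" "base w \<in> line (prol_par b y)"
        by (auto simp only: snd_prolong)
      then obtain a where a: "w = c'.push y a" "push y a \<in> span {push y (spanning b y)}"
        by (auto simp only: c'.tangent_chart line_prol_par[OF b] base_push_prol_par[OF b])
      then obtain k where k: "\<And>n. n < N \<Longrightarrow> a n = k * spanning b y n"
        by (auto simp only: push_mem_span_iff)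
      have "c'.push y a = c'.push y (frame (N + 2) (prol_X b y) (\<lambda>\<kappa>. if \<kappa> = 0 then k else if \<kappa> = 1 then a N else a (Suc N)))"
      proof (rule c'.push_cong)
        fix n assume "n < N + 2"
        then consider "n < N" | "n = N" | "n = Suc N" by linarith
        then show "a n = frame (N + 2) (prol_X b y) (\<lambda>\<kappa>. if \<kappa> = 0 then k else if \<kappa> = 1 then a N else a (Suc N)) n"
          by cases (simp_all add: frame_prol_X frame_prol_X_last k del: add_2_eq_Suc' One_nat_def)
      qed simp
      with a(1) show "w \<in> {c'.push y (frame (N + 2) (prol_X b y) r) |r. True}" by blast
    next
      fix w assume "w \<in> {c'.push y (frame (N + 2) (prol_X b y) r) |r. True}"
      then obtain r where r: "w = c'.push y (frame (N + 2) (prol_X b y) r)" by blast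
      have "push y (frame (N + 2) (prol_X b y) r) \<in> span {push y (spanning b y)}"
        unfolding push_mem_span_iff using frame_prol_X by blast
      then show "w \<in> snd (prolong (S, Del)) (prol_par b y)"
        unfolding snd_prolong c'.tangent_chart r mem_Collect_eq base_push_prol_par[OF b] line_prol_par[OF b]
        by blast
    qed
  qed
qed

end

section \<open>Baby monsters as coordinate slices\<close>

declare prolong.simps [simp del]

lemma tangent_mono: "F \<subseteq> S \<Longrightarrow> tangent F p \<subseteq> tangent S p"
  unfolding tangent_def curve_with_velocity_def by blast

lemma prolong_mono:
  assumes "F \<subseteq> S" "\<And>p. p \<in> F \<Longrightarrow> \<delta> p \<subseteq> D p"
  shows "fst (prolong (F, \<delta>)) \<subseteq> fst (prolong (S, D))"
    and "snd (prolong (F, \<delta>)) q \<subseteq> snd (prolong (S, D)) q"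
proof -
  show 1: "fst (prolong (F, \<delta>)) \<subseteq> fst (prolong (S, D))"
    unfolding subset_iff mem_prolong_iff using assms by blast
  show "snd (prolong (F, \<delta>)) q \<subseteq> snd (prolong (S, D)) q"
    unfolding snd_prolong using tangent_mono[OF 1] by blast
qed

text \<open>
  A curve in a fibre has constant base point, so its velocity projects to \<open>0\<close>, which lies on every line.
\<close>

lemma tangent_fiber_subset:
  assumes F: "F = {q \<in> fst (prolong (S, D)). base q = p0}" and q: "q \<in> F"
  shows "tangent F q \<subseteq> snd (prolong (S, D)) q"
proof
  fix w assume w: "w \<in> tangent F q"
  then obtain \<gamma> where "curve_with_velocity F q w \<gamma>" by (auto simp: tangent_def)
  then obtain e where e: "e > 0" "\<gamma> ` {-e<..<e} \<subseteq> F"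
    and v: "(\<gamma> has_vector_derivative w) (at 0)"
    unfolding curve_with_velocity_def by blast
  have "base w = 0"
  proof (rule poly_mapping_eqI)
    fix a
    have "lookup (\<gamma> t) (Old a) = lookup p0 a" if "t \<in> {-e<..<e}" for t
    proof -
      have "base (\<gamma> t) = p0" using e(2) that F by blast
      then show ?thesis using lookup_base[of "\<gamma> t" a] by simp
    qed
    then have "eventually (\<lambda>t. lookup (\<gamma> t) (Old a) = lookup p0 a) (nhds 0)"
      using eventually_nhds_in_open[of "{-e<..<e}" 0] e(1)
      by (auto elim!: eventually_mono)
    then have "((\<lambda>t. lookup (\<gamma> t) (Old a)) has_real_derivative 0) (at 0)"
      by (subst DERIV_cong_ev[where g = "\<lambda>_. lookup p0 a", OF refl _ refl]) auto
    with lookup_vector_derivative[OF v] have "lookup w (Old a) = 0"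
      by (rule DERIV_unique)
    then show "lookup (base w) a = lookup 0 a" by simp
  qed
  moreover obtain p l where "q = point p l" "is_line l"
    using q unfolding F mem_prolong_iff by blast
  then have "0 \<in> line q" by (simp add: line_point is_line_def subspace_0)
  moreover have "w \<in> tangent (fst (prolong (S, D))) q"
    using w tangent_mono[of F "fst (prolong (S, D))"] F by blast
  ultimately show "w \<in> snd (prolong (S, D)) q" by (simp only: snd_prolong) simp
qed

text \<open>
  The slot of the prolongation of a plane field in slot \<open>\<kappa> \<noteq> b\<close>, when one divides by slot \<open>b\<close>: the
  coordinate obtained from slot \<open>\<kappa>\<close> becomes \<open>u\<close> or \<open>v\<close>.
\<close>

definition carry :: "nat \<Rightarrow> nat \<Rightarrow> nat" where
  "carry b \<kappa> = (if \<kappa> = fst_other b then 1 else 2)"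

context framed_chart
begin

definition plane :: "nat \<Rightarrow> (nat \<Rightarrow> real) \<Rightarrow> ambient set" where
  "plane \<kappa> y = {vec y r |r. r \<kappa> = 0}"

text \<open>
  Within the chart, \<open>F\<close> is cut out by fixing the coordinates in \<open>Z\<close> to their values at \<open>y0\<close>, and \<open>\<delta>\<close> is the
  field of planes in slot \<open>\<kappa>\<close>.  The last clause says that these planes are tangent to \<open>F\<close>; it ensures
  that the lift of a line in such a plane is tangent to the prolongation of \<open>F\<close>.
\<close>

definition slice :: "ambient set \<Rightarrow> (ambient \<Rightarrow> ambient set) \<Rightarrow> (nat \<Rightarrow> real) \<Rightarrow> nat \<Rightarrow> bool" where
  "slice F \<delta> y0 \<kappa> \<longleftrightarrow> \<kappa> < 3 \<and> F \<subseteq> S \<and> (\<forall>p\<in>F. \<delta> p \<subseteq> Del p) \<and>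
     (\<exists>Z\<subseteq>{..<N}. (\<forall>y. \<phi> y \<in> F \<longleftrightarrow> (\<forall>n\<in>Z. y n = y0 n)) \<and>
        (\<forall>y. \<phi> y \<in> F \<longrightarrow> \<delta> (\<phi> y) = plane \<kappa> y \<and>
           (\<forall>r. r \<kappa> = 0 \<longrightarrow> (\<forall>n\<in>Z. frame N (X y) r n = 0))))"

lemma vec_mem_plane_iff:
  assumes "\<kappa> < 3"
  shows "vec y r \<in> plane \<kappa> y \<longleftrightarrow> r \<kappa> = 0"
proof
  assume "vec y r \<in> plane \<kappa> y"
  then obtain r' where "vec y r = vec y r'" "r' \<kappa> = 0" unfolding plane_def by blast
  with vec_inject[OF this(1) assms] show "r \<kappa> = 0" by simp
qed (auto simp: plane_def)

lemma span_vec_subset_plane_iff: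
  assumes "\<kappa> < 3"
  shows "span {vec y r} \<subseteq> plane \<kappa> y \<longleftrightarrow> r \<kappa> = 0"
proof
  assume "span {vec y r} \<subseteq> plane \<kappa> y"
  then show "r \<kappa> = 0" using vec_mem_plane_iff[OF assms] span_base[of "vec y r"] by blast
next
  assume r: "r \<kappa> = 0"
  show "span {vec y r} \<subseteq> plane \<kappa> y"
  proof
    fix w assume "w \<in> span {vec y r}"
    then obtain k where "w = vec y (\<lambda>\<kappa>. k * r \<kappa>)" by (auto simp: span_singleton vec_scale)
    with r show "w \<in> plane \<kappa> y" by (simp add: vec_mem_plane_iff[OF assms])
  qed
qed

lemma slice_cong:
  assumes "slice F \<delta> y \<kappa>" "\<And>n. n < N \<Longrightarrow> y n = y' n"
  shows "slice F \<delta> y' \<kappa>"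
proof -
  obtain Z where Z: "Z \<subseteq> {..<N}" "\<And>x. \<phi> x \<in> F \<longleftrightarrow> (\<forall>n\<in>Z. x n = y n)"
    and "\<forall>x. \<phi> x \<in> F \<longrightarrow> \<delta> (\<phi> x) = plane \<kappa> x \<and> (\<forall>r. r \<kappa> = 0 \<longrightarrow> (\<forall>n\<in>Z. frame N (X x) r n = 0))"
    using assms(1) unfolding slice_def by blast
  moreover have "\<phi> x \<in> F \<longleftrightarrow> (\<forall>n\<in>Z. x n = y' n)" for x
    using Z assms(2) by (metis lessThan_iff subsetD)
  ultimately show ?thesis using assms(1) unfolding slice_def by blast
qed

lemma slice_plane: "slice F \<delta> y \<kappa> \<Longrightarrow> \<phi> y \<in> F \<and> \<delta> (\<phi> y) = plane \<kappa> y"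
  unfolding slice_def by blast

text \<open>
  The fibre fixes all old coordinates and leaves the two new ones free, so its tangent plane is the kernel
  of the differential in slot \<open>0\<close>.
\<close>

lemma slice_fiber:
  assumes b: "b < 3" and F: "F = {q \<in> fst (prolong (S, Del)). base q = \<phi> y0}"
  shows "framed_chart.slice (fst (prolong (S, Del))) (N + 2) (prol_par b)
    (snd (prolong (S, Del))) (prol_X b) F (tangent F) y0 0"
proof -
  interpret c': framed_chart "fst (prolong (S, Del))" "N + 2" "prol_par b" "prol_crd b" "prol_dom b"
    "snd (prolong (S, Del))" "slt b" "prol_X b"
    by (rule framed_chart_prolong[OF b])
  have mem: "prol_par b y \<in> F \<longleftrightarrow> (\<forall>n\<in>{..<N}. y n = y0 n)" for y
    unfolding F using c'.\<phi>_in \<phi>_cong[of y y0] \<phi>_inject[of y y0] by (auto simp: base_prol_par[OF b])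
  have fr: "frame (N + 2) (prol_X b y) r n = 0" if "r 0 = 0" "n < N" for y r n
    using that by (simp only: frame_prol_X mult_zero_left)
  have "tangent F (prol_par b y) = c'.plane 0 y" if y: "prol_par b y \<in> F" for y
  proof -
    have "tangent F (prol_par b y) = {c'.push y a |a. \<forall>n\<in>{..<N}. a n = 0}"
      by (rule c'.tangent_slice[OF _ mem _ y]) (auto simp: F)
    also have "\<dots> = c'.plane 0 y"
    proof (intro equalityI subsetI)
      fix w assume "w \<in> {c'.push y a |a. \<forall>n\<in>{..<N}. a n = 0}"
      then obtain a where a: "w = c'.push y a" "\<And>n. n < N \<Longrightarrow> a n = 0" by blast
      define r :: "nat \<Rightarrow> real" where "r \<kappa> = (if \<kappa> = 0 then 0 else if \<kappa> = 1 then a N else a (Suc N))" for \<kappa>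
      have "c'.push y a = c'.vec y r"
      proof (rule c'.push_cong)
        fix n assume "n < N + 2"
        then consider "n < N" | "n = N" | "n = Suc N" by linarith
        then show "a n = frame (N + 2) (prol_X b y) r n"
          by cases (simp_all add: frame_prol_X frame_prol_X_last a(2) r_def del: add_2_eq_Suc')
      qed simp
      moreover have "r 0 = 0" by (simp add: r_def)
      ultimately show "w \<in> c'.plane 0 y" unfolding c'.plane_def a(1) by blast
    next
      fix w assume "w \<in> c'.plane 0 y"
      then show "w \<in> {c'.push y a |a. \<forall>n\<in>{..<N}. a n = 0}"
        unfolding c'.plane_def using fr by blast
    qed
    finally show ?thesis .
  qed
  moreover have "\<forall>p\<in>F. tangent F p \<subseteq> snd (prolong (S, Del)) p"
    using tangent_fiber_subset[OF F] by blast
  moreover have "F \<subseteq> fst (prolong (S, Del))" unfolding F by blast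
  ultimately show ?thesis
    unfolding c'.slice_def using mem fr
    by (intro conjI exI[of _ "{..<N}"]) auto
qed

text \<open>
  A point over \<open>F\<close> lies on the prolongation exactly if the entry of its line in slot \<open>\<kappa>\<close> is \<open>0\<close>.  That
  entry is one of the two new coordinates, so one more coordinate gets fixed, and the prolonged planes are
  those on which its differential vanishes.
\<close>

lemma slice_prolong:
  assumes b: "b < 3" and sl: "slice F \<delta> y0 \<kappa>" and r: "ratios b y0 \<kappa> = 0"
  shows "framed_chart.slice (fst (prolong (S, Del))) (N + 2) (prol_par b)
    (snd (prolong (S, Del))) (prol_X b) (fst (prolong (F, \<delta>))) (snd (prolong (F, \<delta>))) y0 (carry b \<kappa>)"
proof -
  interpret c': framed_chart "fst (prolong (S, Del))" "N + 2" "prol_par b" "prol_crd b" "prol_dom b"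
    "snd (prolong (S, Del))" "slt b" "prol_X b"
    by (rule framed_chart_prolong[OF b])
  from sl have \<kappa>: "\<kappa> < 3" and FS: "F \<subseteq> S" and \<delta>D: "\<And>p. p \<in> F \<Longrightarrow> \<delta> p \<subseteq> Del p"
    by (simp_all add: slice_def)
  from sl obtain Z where Z: "Z \<subseteq> {..<N}" "\<forall>y. \<phi> y \<in> F \<longleftrightarrow> (\<forall>n\<in>Z. y n = y0 n)"
    and *: "\<forall>y. \<phi> y \<in> F \<longrightarrow> \<delta> (\<phi> y) = plane \<kappa> y \<and> (\<forall>r. r \<kappa> = 0 \<longrightarrow> (\<forall>n\<in>Z. frame N (X y) r n = 0))"
    unfolding slice_def by (elim conjE exE)
  from * have pl: "\<delta> (\<phi> y) = plane \<kappa> y" if "\<phi> y \<in> F" for y using that by simp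
  from * have fr: "frame N (X y) r n = 0" if "\<phi> y \<in> F" "r \<kappa> = 0" "n \<in> Z" for y r n using that by simp
  define F' \<delta>' where "F' = fst (prolong (F, \<delta>))" and "\<delta>' = snd (prolong (F, \<delta>))"
  define m where "m = (if \<kappa> = fst_other b then N else Suc N)"
  have \<kappa>b: "\<kappa> \<noteq> b" using r by (auto simp: ratios_def)
  have ratio: "ratios b y \<kappa> = y m" for y
    using \<kappa>b by (simp add: ratios_def m_def)
  have frame_m: "frame (N + 2) (prol_X b y) r m = r (carry b \<kappa>)" for y r
    by (simp add: m_def carry_def frame_prol_X_last del: add_2_eq_Suc')
  have mem: "prol_par b y \<in> F' \<longleftrightarrow> (\<forall>n\<in>insert m Z. y n = y0 n)" for y
  proof -
    have "prol_par b y \<in> F' \<longleftrightarrow> \<phi> y \<in> F \<and> span {push y (spanning b y)} \<subseteq> \<delta> (\<phi> y)"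
      unfolding F'_def prol_par_def by (rule point_mem_prolong_iff[OF is_line_span_singleton[OF push_spanning_nonzero[OF b]]])
    also have "\<dots> \<longleftrightarrow> \<phi> y \<in> F \<and> ratios b y \<kappa> = 0"
    proof (cases "\<phi> y \<in> F")
      case True
      show ?thesis unfolding spanning_def pl[OF True] span_vec_subset_plane_iff[OF \<kappa>] by blast
    qed simp
    also have "\<dots> \<longleftrightarrow> \<phi> y \<in> F \<and> y m = y0 m" using r by (simp only: ratio)
    also have "\<dots> \<longleftrightarrow> (\<forall>n\<in>insert m Z. y n = y0 n)" using Z(2) by blast
    finally show ?thesis .
  qed
  have zero: "frame (N + 2) (prol_X b y) q n = 0"
    if "prol_par b y \<in> F'" "q (carry b \<kappa>) = 0" "n \<in> insert m Z" for y q n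
  proof (cases "n = m")
    case False
    with that have n: "n \<in> Z" "n < N" using Z by auto
    from that(1) have y: "\<forall>n\<in>insert m Z. y n = y0 n" by (simp only: mem)
    then have yF: "\<phi> y \<in> F" using Z(2) by blast
    have "ratios b y \<kappa> = 0" using r y by (simp add: ratio)
    from fr[of y "ratios b y" n, OF yF this n(1)] have "spanning b y n = 0" by (simp only: spanning_def)
    then show ?thesis by (simp only: frame_prol_X[OF n(2)] mult_zero_right)
  qed (use that frame_m in simp)
  have mono: "F' \<subseteq> fst (prolong (S, Del))" "\<delta>' q \<subseteq> snd (prolong (S, Del)) q" for q
    unfolding F'_def \<delta>'_def by (rule prolong_mono[OF FS \<delta>D]; assumption)+
  have ZN: "insert m Z \<subseteq> {..<N + 2}" using Z by (auto simp: m_def)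
  have "\<delta>' (prol_par b y) = c'.plane (carry b \<kappa>) y" if y: "prol_par b y \<in> F'" for y
  proof (intro equalityI subsetI)
    note tan = c'.tangent_slice[OF mono(1) mem ZN y]
    {
      fix w assume w: "w \<in> \<delta>' (prol_par b y)"
      from subsetD[OF mono(2) w] obtain q where q: "w = c'.vec y q" unfolding c'.Del by blast
      from w have "w \<in> tangent F' (prol_par b y)"
        unfolding \<delta>'_def F'_def snd_prolong by blast
      then obtain a where a: "w = c'.push y a" "a m = 0" unfolding tan by blast
      have "frame (N + 2) (prol_X b y) q m = 0"
        using c'.push_inject[of y "frame (N + 2) (prol_X b y) q" a m] q a ZN by (metis insert_subset lessThan_iff)
      then show "w \<in> c'.plane (carry b \<kappa>) y" unfolding c'.plane_def frame_m q by blast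
    }
    fix w assume "w \<in> c'.plane (carry b \<kappa>) y"
    then obtain q where q: "w = c'.vec y q" "q (carry b \<kappa>) = 0" unfolding c'.plane_def by blast
    then have "w \<in> snd (prolong (S, Del)) (prol_par b y)" unfolding c'.Del by blast
    then have "base w \<in> line (prol_par b y)" unfolding snd_prolong by blast
    moreover have "w \<in> tangent F' (prol_par b y)"
      unfolding tan q(1) using zero[OF y, of q] q(2) by blast
    ultimately show "w \<in> \<delta>' (prol_par b y)"
      unfolding \<delta>'_def F'_def snd_prolong by blast
  qed
  note plane' = this
  have "c'.slice F' \<delta>' y0 (carry b \<kappa>)"
    unfolding c'.slice_def
  proof (intro conjI)
    show "carry b \<kappa> < 3" by (simp add: carry_def)
    show "F' \<subseteq> fst (prolong (S, Del))" by (rule mono)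
    show "\<forall>p\<in>F'. \<delta>' p \<subseteq> snd (prolong (S, Del)) p" using mono by blast
    show "\<exists>Z\<subseteq>{..<N + 2}. (\<forall>y. prol_par b y \<in> F' \<longleftrightarrow> (\<forall>n\<in>Z. y n = y0 n)) \<and>
        (\<forall>y. prol_par b y \<in> F' \<longrightarrow> \<delta>' (prol_par b y) = c'.plane (carry b \<kappa>) y \<and>
           (\<forall>r. r (carry b \<kappa>) = 0 \<longrightarrow> (\<forall>n\<in>Z. frame (N + 2) (prol_X b y) r n = 0)))"
      by (rule exI[of _ "insert m Z"], intro conjI allI impI ballI; (rule ZN mem plane' zero; assumption)?)
  qed
  then show ?thesis by (simp only: F'_def \<delta>'_def)
qed

end

section \<open>The base of the tower\<close>

definition par0 :: "(nat \<Rightarrow> nat) \<Rightarrow> (nat \<Rightarrow> real) \<Rightarrow> ambient" where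
  "par0 s y = (\<Sum>j<3. y j *\<^sub>R Poly_Mapping.single (Coord (s j)) 1)"

definition crd0 :: "(nat \<Rightarrow> nat) \<Rightarrow> nat \<Rightarrow> (index \<Rightarrow> real) \<Rightarrow> real" where
  "crd0 s n z = (if n < 3 then z (Coord (s n)) else 0)"

definition X0 :: "(nat \<Rightarrow> real) \<Rightarrow> nat \<Rightarrow> real" where
  "X0 y n = (if n = 0 then 1 else 0)"

lemma lookup_par0: "lookup (par0 s y) e = (\<Sum>j<3. if Coord (s j) = e then y j else 0)"
  unfolding par0_def lookup_sum by (rule sum.cong) (simp_all add: lookup_single when_def)

lemma lookup_par0_Coord:
  assumes "s permutes {..<3}" "n < 3"
  shows "lookup (par0 s y) (Coord (s n)) = y n"
proof -
  have "s j = s n \<longleftrightarrow> j = n" for j using permutes_inj[OF assms(1)] by (auto dest: injD)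
  then show ?thesis using assms(2) by (simp add: lookup_par0)
qed

lemma chart_R3:
  assumes s: "s permutes {..<3}"
  shows "chart R3 3 (par0 s) (crd0 s) UNIV"
proof
  show "rational_on UNIV (\<lambda>y. lookup (par0 s y) e)" for e
    unfolding lookup_par0 by (intro rational_on_sum rational_on_if rational_on.var rational_on.const)
  have sub: "keys (par0 s y) \<subseteq> Coord ` {..<3}" for y
  proof
    fix e assume "e \<in> keys (par0 s y)"
    then have "\<exists>j<3. Coord (s j) = e"
      unfolding in_keys_iff lookup_par0 by (rule contrapos_np) (auto intro!: sum.neutral)
    then show "e \<in> Coord ` {..<3}" using permutes_in_image[OF s] by auto
  qed
  have "(\<Union>y. keys (par0 s y)) \<subseteq> Coord ` {..<3}" using sub by blast
  then show "finite (\<Union>y. keys (par0 s y))" by (rule finite_subset) simp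
  show "par0 s y \<in> R3" for y using sub by (simp add: R3_def)
  show "par0 s y = par0 s y'" if "\<And>n. n < 3 \<Longrightarrow> y n = y' n" for y y'
    using that by (simp add: par0_def)
  show "crd0 s n (lookup (par0 s y)) = y n" if "n < 3" for n y
    using that by (simp add: crd0_def lookup_par0_Coord[OF s])
  show "par0 s (\<lambda>n. crd0 s n (lookup q)) = q" if "q \<in> R3" for q
  proof (rule poly_mapping_eqI)
    fix e
    show "lookup (par0 s (\<lambda>n. crd0 s n (lookup q))) e = lookup q e"
    proof (cases "e \<in> Coord ` {..<3}")
      case True
      then obtain m where "e = Coord m" "m \<in> {..<3}" by blast
      moreover from this obtain n where "m = s n" "n < 3"
        using permutes_image[OF s] by blast
      ultimately show ?thesis by (simp add: lookup_par0_Coord[OF s] crd0_def)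
    next
      case False
      moreover have "keys q \<subseteq> Coord ` {..<3}" using that by (simp add: R3_def)
      ultimately have "e \<notin> keys (par0 s (\<lambda>n. crd0 s n (lookup q)))" "e \<notin> keys q" using sub by blast+
      then show ?thesis by (simp add: in_keys_iff)
    qed
  qed
  show "rational_on UNIV (crd0 s n)" for n
    unfolding crd0_def[abs_def] by (intro rational_on_if rational_on.var rational_on.const)
qed auto

lemma framed_chart_R3:
  assumes s: "s permutes {..<3}"
  shows "framed_chart R3 3 (par0 s) (crd0 s) UNIV (tangent R3) 0 X0"
proof -
  interpret chart R3 3 "par0 s" "crd0 s" UNIV by (rule chart_R3[OF s])
  show ?thesis
  proof
    fix y
    have "push y a = push y (frame 3 (X0 y) a)" for a
    proof (rule push_cong)
      fix n :: nat assume "n < 3"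
      then consider "n = 0" | "n = 1" | "n = 2" by linarith
      then show "a n = frame 3 (X0 y) a n" by cases (simp_all add: frame_def X0_def)
    qed simp
    then show "tangent R3 (par0 s y) = {push y (frame 3 (X0 y) r) |r. True}"
      unfolding tangent_chart by simp
    show "rational_on UNIV (\<lambda>y. X0 y n)" for n
      unfolding X0_def by (rule rational_on.const)
  qed (auto simp: X0_def)
qed

section \<open>Kumpera--Ruiz coordinates\<close>

lemma M_0: "M 0 = R3" "\<Delta> 0 = tangent R3"
  by (simp_all add: tower_def)

lemma tower_Suc: "tower (Suc i) = prolong (M i, \<Delta> i)"
  by (simp add: tower_def)

text \<open>
  The Baby Monster born at level \<open>m\<close> at the point below \<open>q\<close>, prolonged up to level \<open>i\<close>.
\<close>

definition monster_at :: "nat \<Rightarrow> ambient \<Rightarrow> nat \<Rightarrow> distribution" where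
  "monster_at i q m = baby_monster m (i - m) ((base ^^ (i - m)) q)"

lemma critical_planes_monster_at:
  "critical_planes i q = {snd (monster_at i q m) q |m. 1 \<le> m \<and> m \<le> i \<and> q \<in> fst (monster_at i q m)}"
  by (simp add: critical_planes_def monster_at_def)

lemma monster_at_self: "monster_at i q i = (fiber i q, tangent (fiber i q))"
  by (simp add: monster_at_def baby_monster_def)

lemma monster_at_Suc: "m \<le> i \<Longrightarrow> monster_at (Suc i) q m = prolong (monster_at i (base q) m)"
  by (simp add: monster_at_def baby_monster_def Suc_diff_le funpow_Suc_right del: funpow.simps(2))
     (simp add: funpow_swap1)

text \<open>
  A chart around \<open>\<phi> y \<in> M\<^sup>i\<close> whose coordinates are the Kumpera--Ruiz coordinates belonging to that point, and in which
  the Baby Monsters through the point are slices.  The set \<open>K\<close> consists of their slots.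
\<close>

locale kr_chart = framed_chart "M i" "2 * i + 3" \<phi> \<xi> D "\<Delta> i" f X
  for i :: nat and \<phi> :: "(nat \<Rightarrow> real) \<Rightarrow> ambient" and \<xi> :: "nat \<Rightarrow> (index \<Rightarrow> real) \<Rightarrow> real"
    and D :: "(index \<Rightarrow> real) set" and f :: nat and X :: "(nat \<Rightarrow> real) \<Rightarrow> nat \<Rightarrow> real" +
  fixes s :: "nat \<Rightarrow> nat" and y :: "nat \<Rightarrow> real" and K :: "nat set"
  assumes kr_fst: "\<And>x. fst (kr s i (\<phi> y)) (\<phi> x) = x f"
    and kr_length: "length (snd (kr s i (\<phi> y))) = 2 * i + 3"
    and kr_snd: "\<And>m x. m < 2 * i + 3 \<Longrightarrow> (snd (kr s i (\<phi> y)) ! m) (\<phi> x) = x m"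
    and slots: "\<And>m. 1 \<le> m \<Longrightarrow> m \<le> i \<Longrightarrow> \<phi> y \<in> fst (monster_at i (\<phi> y) m) \<Longrightarrow>
      \<exists>\<kappa>\<in>K. slice (fst (monster_at i (\<phi> y) m)) (snd (monster_at i (\<phi> y) m)) y \<kappa>"
    and slots_born: "\<And>\<kappa>. \<kappa> \<in> K \<Longrightarrow>
      \<exists>m. 1 \<le> m \<and> m \<le> i \<and> slice (fst (monster_at i (\<phi> y) m)) (snd (monster_at i (\<phi> y) m)) y \<kappa>"
    and vertical: "1 \<le> i \<Longrightarrow> 0 \<in> K \<and> slice (fiber i (\<phi> y)) (tangent (fiber i (\<phi> y))) y 0"
begin

lemma slots_less: "\<kappa> \<in> K \<Longrightarrow> \<kappa> < 3"
  using slots_born unfolding slice_def by blast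

lemma slots_level_0: "i = 0 \<Longrightarrow> K = {}"
  using slots_born by fastforce

lemma kr_chart_cong:
  assumes "\<And>n. n < 2 * i + 3 \<Longrightarrow> y n = y' n"
  shows "kr_chart i \<phi> \<xi> D f X s y' K"
proof -
  have e: "\<phi> y = \<phi> y'" by (rule \<phi>_cong[OF assms])
  have sc: "slice F \<delta> y' \<kappa>" if "slice F \<delta> y \<kappa>" for F \<delta> \<kappa>
    by (rule slice_cong[OF that]) (rule assms)
  show ?thesis
  proof (unfold_locales, unfold e[symmetric])
    show "fst (kr s i (\<phi> y)) (\<phi> x) = x f" for x by (rule kr_fst)
    show "length (snd (kr s i (\<phi> y))) = 2 * i + 3" by (rule kr_length)
    show "(snd (kr s i (\<phi> y)) ! m) (\<phi> x) = x m" if "m < 2 * i + 3" for m x by (rule kr_snd[OF that])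
    show "\<exists>\<kappa>\<in>K. slice (fst (monster_at i (\<phi> y) m)) (snd (monster_at i (\<phi> y) m)) y' \<kappa>"
      if m: "1 \<le> m" "m \<le> i" "\<phi> y \<in> fst (monster_at i (\<phi> y) m)" for m
      using slots[OF m] sc by blast
    show "\<exists>m\<ge>1. m \<le> i \<and> slice (fst (monster_at i (\<phi> y) m)) (snd (monster_at i (\<phi> y) m)) y' \<kappa>"
      if "\<kappa> \<in> K" for \<kappa>
      using slots_born[OF that] sc by blast
    show "0 \<in> K \<and> slice (fiber i (\<phi> y)) (tangent (fiber i (\<phi> y))) y' 0" if "1 \<le> i"
      using vertical[OF that] sc by blast
  qed
qed

text \<open>
  The three functions \<open>f\<^sub>i\<close>, \<open>u\<^sub>i\<close>, \<open>v\<^sub>i\<close>, indexed by their slots.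
\<close>

definition krf :: "nat \<Rightarrow> ambient \<Rightarrow> real" where
  "krf \<kappa> = (if \<kappa> = 0 then fst (kr s i (\<phi> y)) else snd (kr s i (\<phi> y)) ! (2 * i + \<kappa>))"

lemma krf_coordinate: "\<kappa> < 3 \<Longrightarrow> krf \<kappa> (\<phi> x) = x (slt \<kappa>)"
proof -
  assume "\<kappa> < 3"
  then consider "\<kappa> = 0" | "\<kappa> = 1" | "\<kappa> = 2" by linarith
  then show ?thesis by cases (simp_all add: krf_def slot_def kr_fst kr_snd)
qed

lemma differential_krf: "\<kappa> < 3 \<Longrightarrow> differential (M i) (krf \<kappa>) (\<phi> x) (push x a) = a (slt \<kappa>)"
  by (rule differential_coordinate[OF krf_coordinate slot_less])

lemma vanishes_krf:
  assumes "b < 3" "\<kappa> < 3"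
  shows "vanishes i (krf \<kappa>) (prol_par b x) \<longleftrightarrow> ratios b x \<kappa> = 0"
proof -
  have "vanishes i (krf \<kappa>) (prol_par b x) \<longleftrightarrow>
      (\<forall>k. differential (M i) (krf \<kappa>) (\<phi> x) (push x (\<lambda>n. k * spanning b x n)) = 0)"
    by (auto simp: vanishes_def line_prol_par[OF assms(1)] base_prol_par[OF assms(1)] span_singleton push_scale)
  also have "\<dots> \<longleftrightarrow> (\<forall>k. k * ratios b x \<kappa> = 0)"
    by (simp only: differential_krf[OF assms(2)] spanning_slot[OF assms(2)])
  also have "\<dots> \<longleftrightarrow> ratios b x \<kappa> = 0" by (metis mult_1 mult_zero_right)
  finally show ?thesis .
qed

lemma ratio_krf:
  assumes "b < 3" "\<kappa> < 3"
  shows "ratio i (krf \<kappa>) (krf b) (prol_par b x) = ratios b x \<kappa>"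
proof -
  define w where "w = (SOME w. w \<in> line (prol_par b x) \<and> w \<noteq> 0)"
  have "push x (spanning b x) \<in> line (prol_par b x) \<and> push x (spanning b x) \<noteq> 0"
    using push_spanning_nonzero[OF assms(1)] by (simp add: line_prol_par[OF assms(1)] span_base)
  then have w: "w \<in> line (prol_par b x)" "w \<noteq> 0"
    unfolding w_def by (metis (mono_tags, lifting) someI)+
  then obtain k where k: "w = push x (\<lambda>n. k * spanning b x n)"
    by (auto simp: line_prol_par[OF assms(1)] span_singleton push_scale)
  with w(2) have "k \<noteq> 0" by (auto simp: push_scale)
  moreover have "ratios b x b = 1" by (simp add: ratios_def)
  ultimately show ?thesis
    unfolding ratio_def w_def[symmetric] Let_def base_prol_par[OF assms(1)] k
      differential_krf[OF assms(2)] differential_krf[OF assms(1)] spanning_slot[OF assms(1)] spanning_slot[OF assms(2)]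
    by simp
qed

lemma kr_prol_par:
  assumes b: "b < 3" "\<And>\<kappa>. \<kappa> < b \<Longrightarrow> ratios b y \<kappa> = 0"
  shows "kr s (Suc i) (prol_par b y) = (krf b \<circ> base, map (\<lambda>c. c \<circ> base) (snd (kr s i (\<phi> y))) @
     [ratio i (krf (fst_other b)) (krf b), ratio i (krf (snd_other b)) (krf b)])"
proof -
  have bb: "ratios b y b \<noteq> 0" by (simp add: ratios_def)
  have krf: "fst (kr s i (\<phi> y)) = krf 0" "snd (kr s i (\<phi> y)) ! (2 * i + 1) = krf 1"
    "snd (kr s i (\<phi> y)) ! (2 * i + 2) = krf 2"
    by (simp_all add: krf_def)
  have "kr s (Suc i) (prol_par b y) =
     (let (h, a, c) = (if \<not> vanishes i (krf 0) (prol_par b y) then (krf 0, krf 1, krf 2)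
          else if \<not> vanishes i (krf 1) (prol_par b y) then (krf 1, krf 0, krf 2)
          else (krf 2, krf 0, krf 1))
      in (h \<circ> base, map (\<lambda>c. c \<circ> base) (snd (kr s i (\<phi> y))) @ [ratio i a h, ratio i c h]))"
    unfolding kr.simps base_prol_par[OF b(1)] krf[symmetric] by (simp add: Let_def case_prod_beta)
  moreover from b(1) consider "b = 0" | "b = 1" | "b = 2" by linarith
  then have "(if \<not> vanishes i (krf 0) (prol_par b y) then (krf 0, krf 1, krf 2)
          else if \<not> vanishes i (krf 1) (prol_par b y) then (krf 1, krf 0, krf 2)
          else (krf 2, krf 0, krf 1)) = (krf b, krf (fst_other b), krf (snd_other b))"
    using b(2) bb by cases (simp_all add: vanishes_krf fst_other_def snd_other_def)
  ultimately show ?thesis by simp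
qed

lemma other_less: "fst_other b < 3" "snd_other b < 3"
  by (simp_all add: fst_other_def snd_other_def)

text \<open>
  The monsters through a point of the prolongation are the newborn one, which is its fibre, and the prolongations of those old
  ones whose planes contain the line, that is, whose slot has ratio \<open>0\<close>.  The condition that
  the ratios before \<open>b\<close> vanish says that slot \<open>b\<close> is the left-most one that does not vanish on the line, so
  that the Kumpera--Ruiz construction divides by it.
\<close>

theorem kr_chart_prolong:
  assumes b: "b < 3" "\<And>\<kappa>. \<kappa> < b \<Longrightarrow> ratios b y \<kappa> = 0"
  shows "kr_chart (Suc i) (prol_par b) (prol_crd b) (prol_dom b) (slt b) (prol_X b) s y
           (insert 0 (carry b ` {\<kappa> \<in> K. ratios b y \<kappa> = 0}))"
proof -
  have N: "2 * Suc i + 3 = 2 * i + 3 + 2" by simp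
  let ?q = "prol_par b y" and ?K = "insert 0 (carry b ` {\<kappa> \<in> K. ratios b y \<kappa> = 0})"
  interpret c': framed_chart "M (Suc i)" "2 * Suc i + 3" "prol_par b" "prol_crd b" "prol_dom b" "\<Delta> (Suc i)" "slt b" "prol_X b"
    unfolding tower_Suc N by (rule framed_chart_prolong[OF b(1)])
  have slice_eq: "c'.slice = framed_chart.slice (fst (prolong (M i, \<Delta> i))) (2 * i + 3 + 2) (prol_par b)
    (snd (prolong (M i, \<Delta> i))) (prol_X b)"
    unfolding tower_Suc N ..
  have fib: "c'.slice (fiber (Suc i) ?q) (tangent (fiber (Suc i) ?q)) y 0"
    unfolding slice_eq
    by (rule slice_fiber[OF b(1)]) (simp add: fiber_def tower_Suc base_prol_par[OF b(1)])
  have step: "c'.slice (fst (monster_at (Suc i) ?q m)) (snd (monster_at (Suc i) ?q m)) y (carry b \<kappa>)"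
    if "m \<le> i" "slice (fst (monster_at i (\<phi> y) m)) (snd (monster_at i (\<phi> y) m)) y \<kappa>"
      "ratios b y \<kappa> = 0" for m \<kappa>
    using slice_prolong[OF b(1) that(2,3)] that(1)
    by (simp only: slice_eq monster_at_Suc base_prol_par[OF b(1)] prod.collapse)
  show ?thesis
  proof
    show "fst (kr s (Suc i) ?q) (prol_par b x) = x (slt b)" for x
      by (simp add: kr_prol_par[OF b] base_prol_par[OF b(1)] krf_coordinate[OF b(1)] del: kr.simps)
    show "length (snd (kr s (Suc i) ?q)) = 2 * Suc i + 3"
      by (simp add: kr_prol_par[OF b] kr_length del: kr.simps)
    show "(snd (kr s (Suc i) ?q) ! m) (prol_par b x) = x m" if "m < 2 * Suc i + 3" for m x
    proof -
      have "m < 2 * i + 3 \<or> m = 2 * i + 3 \<or> m = Suc (2 * i + 3)" using that by presburger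
      then consider "m < 2 * i + 3" | "m = 2 * i + 3" | "m = Suc (2 * i + 3)" by blast
      then show ?thesis
      proof cases
        case 1
        then show ?thesis
          by (simp add: kr_prol_par[OF b] nth_append kr_length kr_snd base_prol_par[OF b(1)] del: kr.simps)
      next
        case 2
        have "fst_other b \<noteq> b" by (auto simp: fst_other_def)
        with 2 show ?thesis
          by (simp add: kr_prol_par[OF b] nth_append kr_length ratio_krf[OF b(1) other_less(1)] ratios_def
              del: kr.simps)
      next
        case 3
        have "snd_other b \<noteq> b" "snd_other b \<noteq> fst_other b" by (auto simp: fst_other_def snd_other_def)
        with 3 show ?thesis
          by (simp add: kr_prol_par[OF b] nth_append kr_length ratio_krf[OF b(1) other_less(2)] ratios_def
              del: kr.simps)
      qed
    qed
  next
    fix m assume m: "1 \<le> m" "m \<le> Suc i" "?q \<in> fst (monster_at (Suc i) ?q m)"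
    show "\<exists>\<kappa>\<in>?K. c'.slice (fst (monster_at (Suc i) ?q m)) (snd (monster_at (Suc i) ?q m)) y \<kappa>"
    proof (cases "m = Suc i")
      case True
      with fib show ?thesis by (auto simp: monster_at_self)
    next
      case False
      with m have mi: "m \<le> i" by simp
      have "point (\<phi> y) (span {push y (spanning b y)}) \<in>
          fst (prolong (fst (monster_at i (\<phi> y) m), snd (monster_at i (\<phi> y) m)))"
        using m(3) unfolding monster_at_Suc[OF mi] base_prol_par[OF b(1)] prod.collapse
        unfolding prol_par_def .
      then have mem: "\<phi> y \<in> fst (monster_at i (\<phi> y) m)"
        and sub: "span {push y (spanning b y)} \<subseteq> snd (monster_at i (\<phi> y) m) (\<phi> y)"
        using point_mem_prolong_iff[OF is_line_span_singleton[OF push_spanning_nonzero[OF b(1)]]] by blast+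
      obtain \<kappa> where \<kappa>: "\<kappa> \<in> K" "slice (fst (monster_at i (\<phi> y) m)) (snd (monster_at i (\<phi> y) m)) y \<kappa>"
        using slots[OF m(1) mi mem] by blast
      have "ratios b y \<kappa> = 0"
        using sub unfolding slice_plane[OF \<kappa>(2), THEN conjunct2] spanning_def
          span_vec_subset_plane_iff[OF slots_less[OF \<kappa>(1)]] .
      with step[OF mi \<kappa>(2)] \<kappa>(1) show ?thesis by blast
    qed
  next
    fix \<kappa>' assume "\<kappa>' \<in> ?K"
    then consider "\<kappa>' = 0" | \<kappa> where "\<kappa> \<in> K" "ratios b y \<kappa> = 0" "\<kappa>' = carry b \<kappa>" by blast
    then show "\<exists>m\<ge>1. m \<le> Suc i \<and>
        c'.slice (fst (monster_at (Suc i) ?q m)) (snd (monster_at (Suc i) ?q m)) y \<kappa>'"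
    proof cases
      case 1
      with fib show ?thesis by (intro exI[of _ "Suc i"]) (simp add: monster_at_self)
    next
      case 2
      from slots_born[OF 2(1)] obtain m where "1 \<le> m" "m \<le> i"
        "slice (fst (monster_at i (\<phi> y) m)) (snd (monster_at i (\<phi> y) m)) y \<kappa>" by blast
      with step[OF this(2,3) 2(2)] 2(3) show ?thesis by (intro exI[of _ m]) auto
    qed
  next
    show "0 \<in> ?K \<and> c'.slice (fiber (Suc i) ?q) (tangent (fiber (Suc i) ?q)) y 0" using fib by blast
  qed
qed

end

section \<open>Letters\<close>

text \<open>
  The letter of a line with homogeneous coordinates \<open>r\<close> if the critical planes are those in the slots \<open>K\<close>:
  \<open>V\<close>, \<open>T\<^sub>1\<close>, \<open>T\<^sub>2\<close> are the planes in the slots \<open>0\<close>, \<open>1\<close>, \<open>2\<close>.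
\<close>

definition letter_for :: "nat set \<Rightarrow> (nat \<Rightarrow> real) \<Rightarrow> letter" where
  "letter_for K r =
     (if {0, 1} \<subseteq> K \<and> r 0 = 0 \<and> r 1 = 0 then L1
      else if {1, 2} \<subseteq> K \<and> r 1 = 0 \<and> r 2 = 0 then L2
      else if {0, 2} \<subseteq> K \<and> r 0 = 0 \<and> r 2 = 0 then L3
      else if 0 \<in> K \<and> r 0 = 0 then V
      else if 1 \<in> K \<and> r 1 = 0 then T1
      else if 2 \<in> K \<and> r 2 = 0 then T2
      else R)"

definition lead :: "(nat \<Rightarrow> real) \<Rightarrow> nat" where
  "lead r = (if r 0 \<noteq> 0 then 0 else if r 1 \<noteq> 0 then 1 else 2)"

text \<open>
  The slots of the critical planes at the next point: \<open>0\<close> for the newborn monster, and the new slots of the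
  surviving ones.
\<close>

definition next_slots :: "nat set \<Rightarrow> (nat \<Rightarrow> real) \<Rightarrow> nat set" where
  "next_slots K r = insert 0 (carry (lead r) ` {\<kappa> \<in> K. r \<kappa> = 0})"

definition nonzero :: "(nat \<Rightarrow> real) \<Rightarrow> bool" where
  "nonzero r \<longleftrightarrow> r 0 \<noteq> 0 \<or> r 1 \<noteq> 0 \<or> r 2 \<noteq> 0"

lemma nonzero_iff: "nonzero r \<longleftrightarrow> (\<exists>\<kappa><3. r \<kappa> \<noteq> 0)"
proof
  assume "\<exists>\<kappa><3. r \<kappa> \<noteq> 0"
  then obtain \<kappa> where k: "\<kappa> < 3" "r \<kappa> \<noteq> 0" by blast
  then consider "\<kappa> = 0" | "\<kappa> = 1" | "\<kappa> = 2" by linarith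
  then show "nonzero r" using k by cases (auto simp: nonzero_def)
next
  have "0 < (3 :: nat)" "1 < (3 :: nat)" "2 < (3 :: nat)" by simp_all
  then show "nonzero r \<Longrightarrow> \<exists>\<kappa><3. r \<kappa> \<noteq> 0" unfolding nonzero_def by blast
qed

lemma lead_nonzero: "nonzero r \<Longrightarrow> r (lead r) \<noteq> 0"
  by (auto simp: nonzero_def lead_def)

lemma lead_less: "lead r < 3"
  by (simp add: lead_def)

lemma lead_leftmost:
  assumes "\<kappa> < lead r"
  shows "r \<kappa> = 0"
proof -
  have "\<kappa> = 0 \<or> \<kappa> = 1" using assms lead_less[of r] by linarith
  then show ?thesis using assms by (auto simp: lead_def split: if_splits)
qed

text \<open>
  This forgets the chart and keeps what the RVT code depends on.
\<close>

definition coded :: "(nat \<Rightarrow> nat) \<Rightarrow> nat \<Rightarrow> ambient \<Rightarrow> nat set \<Rightarrow> bool" where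
  "coded s i q K \<longleftrightarrow> (\<exists>\<phi> \<xi> D f X y. kr_chart i \<phi> \<xi> D f X s y K \<and> q = \<phi> y)"

context kr_chart
begin

lemma critical_planes_eq: "critical_planes i (\<phi> y) = (\<lambda>\<kappa>. plane \<kappa> y) ` K"
proof (intro equalityI subsetI)
  fix P assume "P \<in> critical_planes i (\<phi> y)"
  then obtain m where m: "1 \<le> m" "m \<le> i" "\<phi> y \<in> fst (monster_at i (\<phi> y) m)"
    "P = snd (monster_at i (\<phi> y) m) (\<phi> y)"
    unfolding critical_planes_monster_at by blast
  from slots[OF m(1-3)] obtain \<kappa> where \<kappa>: "\<kappa> \<in> K"
    "slice (fst (monster_at i (\<phi> y) m)) (snd (monster_at i (\<phi> y) m)) y \<kappa>" by blast
  from slice_plane[OF \<kappa>(2)] have "P = plane \<kappa> y" by (simp only: m(4))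
  with \<kappa>(1) show "P \<in> (\<lambda>\<kappa>. plane \<kappa> y) ` K" by (rule image_eqI[rotated])
next
  fix P assume "P \<in> (\<lambda>\<kappa>. plane \<kappa> y) ` K"
  then obtain \<kappa> where \<kappa>: "\<kappa> \<in> K" "P = plane \<kappa> y" by blast
  from slots_born[OF \<kappa>(1)] obtain m where m: "1 \<le> m" "m \<le> i"
    "slice (fst (monster_at i (\<phi> y) m)) (snd (monster_at i (\<phi> y) m)) y \<kappa>" by blast
  from slice_plane[OF m(3)] have "\<phi> y \<in> fst (monster_at i (\<phi> y) m)"
    "P = snd (monster_at i (\<phi> y) m) (\<phi> y)" using \<kappa>(2) by auto
  with m(1,2) show "P \<in> critical_planes i (\<phi> y)"
    unfolding critical_planes_monster_at by blast
qed

lemma dv_eq: "dv s i (\<phi> y) = vec y (\<lambda>\<kappa>. if \<kappa> = 2 then 1 else 0)"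
proof -
  have diff: "differential (M i) (snd (kr s i (\<phi> y)) ! m) (\<phi> y) (push y a) = a m"
    if "m < 2 * i + 3" for m a
    by (rule differential_coordinate[OF kr_snd[OF that] that])
  have fr: "frame (2 * i + 3) (X y) (\<lambda>\<kappa>. if \<kappa> = 2 then 1 else 0) m = (if m = 2 * i + 2 then 1 else 0)" for m
    by (simp add: frame_def)
  show ?thesis
    unfolding dv_def coordinate_vector_def kr_length
  proof (rule the_equality)
    show "vec y (\<lambda>\<kappa>. if \<kappa> = 2 then 1 else 0) \<in> tangent (M i) (\<phi> y) \<and>
        (\<forall>m<2 * i + 3. differential (M i) (snd (kr s i (\<phi> y)) ! m) (\<phi> y)
           (vec y (\<lambda>\<kappa>. if \<kappa> = 2 then 1 else 0)) = (if m = 2 * i + 2 then 1 else 0))"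
      unfolding tangent_chart
    proof (intro conjI allI impI)
      fix m assume "m < 2 * i + 3"
      then show "differential (M i) (snd (kr s i (\<phi> y)) ! m) (\<phi> y)
           (vec y (\<lambda>\<kappa>. if \<kappa> = 2 then 1 else 0)) = (if m = 2 * i + 2 then 1 else 0)"
        by (simp only: diff fr)
    qed blast
  next
    fix w assume w: "w \<in> tangent (M i) (\<phi> y) \<and>
        (\<forall>m<2 * i + 3. differential (M i) (snd (kr s i (\<phi> y)) ! m) (\<phi> y) w = (if m = 2 * i + 2 then 1 else 0))"
    then obtain a where a: "w = push y a" unfolding tangent_chart by blast
    have "a m = (if m = 2 * i + 2 then 1 else 0)" if "m < 2 * i + 3" for m
      using w diff[OF that, of a] that unfolding a by simp
    then show "w = vec y (\<lambda>\<kappa>. if \<kappa> = 2 then 1 else 0)"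
      unfolding a by (intro push_cong) (simp_all add: fr)
  qed
qed

lemma plane_inject:
  assumes "plane \<kappa> y = plane \<kappa>' y" "\<kappa> < 3" "\<kappa>' < 3"
  shows "\<kappa> = \<kappa>'"
proof (rule ccontr)
  assume "\<kappa> \<noteq> \<kappa>'"
  then have "vec y (\<lambda>j. if j = \<kappa> then 0 else 1) \<in> plane \<kappa> y - plane \<kappa>' y"
    by (simp add: vec_mem_plane_iff assms(2,3))
  with assms(1) show False by blast
qed

lemma V_plane_eq: "V_plane i (\<phi> y) = {plane 0 y |_::unit. 0 \<in> K}"
proof (cases "i = 0")
  case True
  have K: "K = {}" using slots_level_0[OF True] .
  have "critical_planes i (\<phi> y) = {}" unfolding critical_planes_eq K by simp
  with K show ?thesis unfolding V_plane_def by blast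
next
  case False
  then have K: "0 \<in> K" "slice (fiber i (\<phi> y)) (tangent (fiber i (\<phi> y))) y 0" using vertical by auto
  have "snd (baby_monster i 0 (\<phi> y)) (\<phi> y) = plane 0 y"
    using slice_plane[OF K(2)] by (simp add: baby_monster_def)
  then show ?thesis using K(1) by (auto simp: V_plane_def critical_planes_eq)
qed

lemma dv_mem_plane_iff: "\<kappa> \<in> K \<Longrightarrow> dv s i (\<phi> y) \<in> plane \<kappa> y \<longleftrightarrow> \<kappa> \<noteq> 2"
  using slots_less by (simp add: dv_eq vec_mem_plane_iff)

lemma slot_cases: "\<kappa> \<in> K \<Longrightarrow> \<kappa> = 0 \<or> \<kappa> = 1 \<or> \<kappa> = 2"
  using slots_less[of \<kappa>] by linarith

lemma T1_plane_eq: "T1_plane s i (\<phi> y) = {plane 1 y |_::unit. 1 \<in> K}"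
proof -
  have "P \<in> T1_plane s i (\<phi> y) \<longleftrightarrow> (\<exists>\<kappa>\<in>K. P = plane \<kappa> y \<and> \<kappa> \<noteq> 0 \<and> \<kappa> \<noteq> 2)" for P
  proof -
    have "P \<in> T1_plane s i (\<phi> y) \<longleftrightarrow>
        (\<exists>\<kappa>\<in>K. P = plane \<kappa> y \<and> plane \<kappa> y \<notin> V_plane i (\<phi> y) \<and> dv s i (\<phi> y) \<in> plane \<kappa> y)"
      unfolding T1_plane_def critical_planes_eq by blast
    also have "\<dots> \<longleftrightarrow> (\<exists>\<kappa>\<in>K. P = plane \<kappa> y \<and> \<kappa> \<noteq> 0 \<and> \<kappa> \<noteq> 2)"
    proof (rule bex_cong[OF refl])
      fix \<kappa> assume \<kappa>: "\<kappa> \<in> K"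
      have "plane \<kappa> y \<in> V_plane i (\<phi> y) \<longleftrightarrow> \<kappa> = 0"
        using plane_inject[of \<kappa> 0] slots_less[OF \<kappa>] \<kappa> by (auto simp: V_plane_eq)
      then show "(P = plane \<kappa> y \<and> plane \<kappa> y \<notin> V_plane i (\<phi> y) \<and> dv s i (\<phi> y) \<in> plane \<kappa> y) \<longleftrightarrow>
          (P = plane \<kappa> y \<and> \<kappa> \<noteq> 0 \<and> \<kappa> \<noteq> 2)"
        by (simp add: dv_mem_plane_iff[OF \<kappa>])
    qed
    finally show ?thesis .
  qed
  moreover have "\<kappa> \<in> K \<and> \<kappa> \<noteq> 0 \<and> \<kappa> \<noteq> 2 \<longleftrightarrow> 1 \<in> K \<and> \<kappa> = 1" for \<kappa>
    using slot_cases[of \<kappa>] by auto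
  then have "(\<exists>\<kappa>\<in>K. P = plane \<kappa> y \<and> \<kappa> \<noteq> 0 \<and> \<kappa> \<noteq> 2) \<longleftrightarrow> P = plane 1 y \<and> 1 \<in> K" for P
    by metis
  ultimately show ?thesis by (simp add: set_eq_iff)
qed

lemma T2_plane_eq: "T2_plane s i (\<phi> y) = {plane 2 y |_::unit. 2 \<in> K}"
proof -
  have "P \<in> T2_plane s i (\<phi> y) \<longleftrightarrow> (\<exists>\<kappa>\<in>K. P = plane \<kappa> y \<and> \<kappa> = 2)" for P
  proof -
    have "P \<in> T2_plane s i (\<phi> y) \<longleftrightarrow> (\<exists>\<kappa>\<in>K. P = plane \<kappa> y \<and> dv s i (\<phi> y) \<notin> plane \<kappa> y)"
      unfolding T2_plane_def critical_planes_eq by blast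
    also have "\<dots> \<longleftrightarrow> (\<exists>\<kappa>\<in>K. P = plane \<kappa> y \<and> \<kappa> = 2)"
      by (rule bex_cong[OF refl]) (simp add: dv_mem_plane_iff)
    finally show ?thesis .
  qed
  then show ?thesis by (auto simp: set_eq_iff)
qed

text \<open>
  Two distinct slot planes meet in the line on which only the third entry is nonzero.
\<close>

lemma line_eq_planes_iff:
  assumes r: "nonzero r" and \<kappa>: "\<kappa> < 3" "\<kappa>' < 3" "\<kappa> \<noteq> \<kappa>'"
  shows "span {vec y r} = plane \<kappa> y \<inter> plane \<kappa>' y \<longleftrightarrow> r \<kappa> = 0 \<and> r \<kappa>' = 0"
proof
  assume "span {vec y r} = plane \<kappa> y \<inter> plane \<kappa>' y"
  then show "r \<kappa> = 0 \<and> r \<kappa>' = 0"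
    using span_vec_subset_plane_iff[OF \<kappa>(1)] span_vec_subset_plane_iff[OF \<kappa>(2)] by blast
next
  assume r0: "r \<kappa> = 0 \<and> r \<kappa>' = 0"
  \<comment> \<open>the third slot, since all three add up to \<open>3\<close>\<close>
  define j where "j = 3 - \<kappa> - \<kappa>'"
  have j: "n = \<kappa> \<or> n = \<kappa>' \<or> n = j" if "n < 3" for n
    using that \<kappa> unfolding j_def by linarith
  have rj: "r j \<noteq> 0" using r r0 j unfolding nonzero_iff by blast
  show "span {vec y r} = plane \<kappa> y \<inter> plane \<kappa>' y"
  proof (intro equalityI subsetI)
    fix w assume "w \<in> span {vec y r}"
    then show "w \<in> plane \<kappa> y \<inter> plane \<kappa>' y"
      using span_vec_subset_plane_iff[OF \<kappa>(1)] span_vec_subset_plane_iff[OF \<kappa>(2)] r0 by blast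
  next
    fix w assume w: "w \<in> plane \<kappa> y \<inter> plane \<kappa>' y"
    then obtain r' where r': "w = vec y r'" "r' \<kappa> = 0" unfolding plane_def by blast
    with w have "r' \<kappa>' = 0" using vec_mem_plane_iff[OF \<kappa>(2)] by blast
    with r' r0 rj j have "r' n = (r' j / r j) * r n" if "n < 3" for n
      using j[OF that] by auto
    then have "w = vec y (\<lambda>n. (r' j / r j) * r n)" unfolding r'(1) by (rule vec_cong)
    then show "w \<in> span {vec y r}" by (simp only: vec_scale span_singleton) blast
  qed
qed

lemma letter_of_eq:
  assumes "nonzero r"
  shows "letter_of s i (\<phi> y) (span {vec y r}) = letter_for K r"
proof -
  have "span {vec y r} \<in> L1_line s i (\<phi> y) \<longleftrightarrow> {0, 1} \<subseteq> K \<and> r 0 = 0 \<and> r 1 = 0"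
    using line_eq_planes_iff[OF assms, of 0 1] by (auto simp: L1_line_def V_plane_eq T1_plane_eq)
  moreover have "span {vec y r} \<in> L2_line s i (\<phi> y) \<longleftrightarrow> {1, 2} \<subseteq> K \<and> r 1 = 0 \<and> r 2 = 0"
    using line_eq_planes_iff[OF assms, of 1 2] by (auto simp: L2_line_def T1_plane_eq T2_plane_eq)
  moreover have "span {vec y r} \<in> L3_line s i (\<phi> y) \<longleftrightarrow> {0, 2} \<subseteq> K \<and> r 0 = 0 \<and> r 2 = 0"
    using line_eq_planes_iff[OF assms, of 0 2] by (auto simp: L3_line_def V_plane_eq T2_plane_eq)
  moreover have "(\<exists>P\<in>V_plane i (\<phi> y). span {vec y r} \<subseteq> P) \<longleftrightarrow> 0 \<in> K \<and> r 0 = 0"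
    using span_vec_subset_plane_iff[of 0 y r] by (auto simp: V_plane_eq)
  moreover have "(\<exists>P\<in>T1_plane s i (\<phi> y). span {vec y r} \<subseteq> P) \<longleftrightarrow> 1 \<in> K \<and> r 1 = 0"
    using span_vec_subset_plane_iff[of 1 y r] by (auto simp: T1_plane_eq)
  moreover have "(\<exists>P\<in>T2_plane s i (\<phi> y). span {vec y r} \<subseteq> P) \<longleftrightarrow> 2 \<in> K \<and> r 2 = 0"
    using span_vec_subset_plane_iff[of 2 y r] by (auto simp: T2_plane_eq)
  ultimately show ?thesis unfolding letter_of_def letter_for_def by presburger
qed

text \<open>
  Division by the leading nonzero entry yields a chart around the new point that
  satisfies the hypothesis of \<open>kr_chart_prolong\<close>.
\<close>

lemma coded_point:
  assumes "nonzero r"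
  shows "coded s (Suc i) (point (\<phi> y) (span {vec y r})) (next_slots K r)"
proof -
  define b where "b = lead r"
  have b: "b < 3" "r b \<noteq> 0" using lead_less lead_nonzero[OF assms] by (auto simp: b_def)
  define y' where "y' n = (if n < 2 * i + 3 then y n
    else if n = 2 * i + 3 then r (fst_other b) / r b else r (snd_other b) / r b)" for n
  have y': "y' (2 * i + 3) = r (fst_other b) / r b" "y' (Suc (2 * i + 3)) = r (snd_other b) / r b"
    "n < 2 * i + 3 \<Longrightarrow> y n = y' n" for n
    by (simp_all add: y'_def)
  have q: "prol_par b y' = point (\<phi> y) (span {vec y r})"
    by (rule prol_par_eq[of b r, OF b]) (simp_all add: y'_def)
  have ratios: "ratios b y' \<kappa> = r \<kappa> / r b" if "\<kappa> < 3" for \<kappa>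
    by (rule ratios_eq[of b r, OF b y'(1,2) that])
  interpret c: kr_chart i \<phi> \<xi> D f X s y' K by (rule kr_chart_cong[OF y'(3)])
  have "ratios b y' \<kappa> = 0" if "\<kappa> < b" for \<kappa>
    using that b(1) ratios[of \<kappa>] lead_leftmost[of \<kappa> r] by (simp add: b_def)
  note kr = c.kr_chart_prolong[OF b(1) this]
  have "{\<kappa> \<in> K. ratios b y' \<kappa> = 0} = {\<kappa> \<in> K. r \<kappa> = 0}"
    using ratios slots_less b(2) by auto
  then have "insert 0 (carry b ` {\<kappa> \<in> K. ratios b y' \<kappa> = 0}) = next_slots K r"
    by (simp only: next_slots_def b_def)
  with kr q show ?thesis unfolding coded_def by metis
qed

end

lemma coded_line:
  assumes "coded s i q K" "is_line l" "l \<subseteq> \<Delta> i q"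
  shows "\<exists>r. nonzero r \<and> letter_of s i q l = letter_for K r \<and> coded s (Suc i) (point q l) (next_slots K r)"
proof -
  from assms(1) obtain \<phi> \<xi> D f X y where "kr_chart i \<phi> \<xi> D f X s y K" and q: "q = \<phi> y"
    unfolding coded_def by blast
  then interpret kr_chart i \<phi> \<xi> D f X s y K by blast
  obtain r where r: "l = span {vec y r}" "vec y r \<noteq> 0"
    using is_line_Del[OF assms(2)] assms(3) q by blast
  from r(2) have "nonzero r" unfolding vec_eq_0_iff nonzero_iff by blast
  then show ?thesis unfolding q r(1) using letter_of_eq coded_point by blast
qed

lemma coded_direction:
  assumes "coded s i q K" "nonzero r"
  shows "\<exists>l. is_line l \<and> l \<subseteq> \<Delta> i q \<and> letter_of s i q l = letter_for K r \<and>
    coded s (Suc i) (point q l) (next_slots K r)"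
proof -
  from assms(1) obtain \<phi> \<xi> D f X y where "kr_chart i \<phi> \<xi> D f X s y K" and q: "q = \<phi> y"
    unfolding coded_def by blast
  then interpret kr_chart i \<phi> \<xi> D f X s y K by blast
  have "vec y r \<noteq> 0" using assms(2) unfolding vec_eq_0_iff nonzero_iff by blast
  then have "is_line (span {vec y r})" by (rule is_line_span_singleton)
  then show ?thesis
    unfolding q using span_vec_subset_Del letter_of_eq[OF assms(2)] coded_point[OF assms(2)] by blast
qed

lemma coded_R3:
  assumes s: "s permutes {..<3}" and q: "q \<in> R3"
  shows "coded s 0 q {}"
proof -
  interpret framed_chart R3 3 "par0 s" "crd0 s" UNIV "tangent R3" 0 X0
    by (rule framed_chart_R3[OF s])
  define y where "y n = crd0 s n (lookup q)" for n
  have "kr_chart 0 (par0 s) (crd0 s) UNIV 0 X0 s y {}"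
  proof (rule kr_chart.intro)
    show "framed_chart (M 0) (2 * 0 + 3) (par0 s) (crd0 s) UNIV (\<Delta> 0) 0 X0"
      using framed_chart_R3[OF s] by (simp add: M_0)
    show "kr_chart_axioms 0 (par0 s) 0 X0 s y {}"
    proof
      show "(snd (kr s 0 (par0 s y)) ! m) (par0 s x) = x m" if "m < 2 * 0 + 3" for m x
      proof -
        from that consider "m = 0" | "m = 1" | "m = 2" by linarith
        then show ?thesis by cases (simp_all add: xyz_def lookup_par0_Coord[OF s])
      qed
    qed (simp_all add: xyz_def lookup_par0_Coord[OF s])
  qed
  moreover have "q = par0 s y" using \<phi>_\<xi>[of q] q by (simp add: y_def[abs_def])
  ultimately show ?thesis unfolding coded_def by blast
qed

section \<open>Words\<close>

text \<open>
  The states of the automaton: the slots of the critical planes at a point depend only on its letter.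
\<close>

definition slots_after :: "letter \<Rightarrow> nat set" where
  "slots_after a = (case a of R \<Rightarrow> {0} | V \<Rightarrow> {0, 1} | T1 \<Rightarrow> {0, 1} | T2 \<Rightarrow> {0, 2} | _ \<Rightarrow> {0, 1, 2})"

definition may_follow :: "letter \<Rightarrow> letter \<Rightarrow> bool" where
  "may_follow a c \<longleftrightarrow> (a = R \<longrightarrow> c \<in> {R, V}) \<and> (a \<in> {V, T1} \<longrightarrow> c \<in> {R, V, T1, L1}) \<and>
     (a = T2 \<longrightarrow> c \<in> {R, V, T2, L3}) \<and> (a \<in> {L1, L2, L3} \<longrightarrow> c \<in> UNIV)"

lemma next_slots_level_0: "letter_for {} r = R" "next_slots {} r = slots_after R"
  by (simp_all add: letter_for_def next_slots_def slots_after_def)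

lemma next_slots_UN:
  "next_slots K r = insert 0 (\<Union>\<kappa>\<in>K. if r \<kappa> = 0 then {carry (lead r) \<kappa>} else {})"
proof -
  have "carry (lead r) ` {\<kappa> \<in> K. r \<kappa> = 0} = (\<Union>\<kappa>\<in>K. if r \<kappa> = 0 then {carry (lead r) \<kappa>} else {})"
    by (auto split: if_splits)
  then show ?thesis by (simp only: next_slots_def)
qed

text \<open>
  Each slot \<open>\<kappa>\<close> of a critical plane with \<open>r\<^sub>\<kappa> = 0\<close> adds one slot besides \<open>0\<close>, and different \<open>\<kappa>\<close> add different
  slots.  If there is just one such \<open>\<kappa>\<close>, it adds slot \<open>1\<close> for the letters \<open>V\<close> and \<open>T\<^sub>1\<close> and slot \<open>2\<close> for \<open>T\<^sub>2\<close>;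
  for \<open>L\<^sub>1\<close>, \<open>L\<^sub>2\<close>, \<open>L\<^sub>3\<close> there are two, which add both.
\<close>

lemma next_slots_eq:
  assumes "nonzero r"
  shows "next_slots (slots_after a) r = slots_after (letter_for (slots_after a) r)"
proof -
  consider "slots_after a = {0}" | "slots_after a = {0, 1}" | "slots_after a = {0, 2}"
    | "slots_after a = {0, 1, 2}"
    by (cases a) (simp_all add: slots_after_def)
  then show ?thesis
    using assms
    by cases (cases "r 0 = 0"; cases "r 1 = 0"; cases "r 2 = 0";
      simp add: next_slots_UN lead_def nonzero_def letter_for_def carry_def fst_other_def
        slots_after_def insert_commute)+
qed

lemma letter_for_may_follow: "nonzero r \<Longrightarrow> may_follow a (letter_for (slots_after a) r)"
  by (cases a) (auto simp: nonzero_def letter_for_def slots_after_def may_follow_def)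

text \<open>
  For each letter, homogeneous coordinates of a line that lies in just the slot planes which define the
  letter.
\<close>

definition direction :: "letter \<Rightarrow> nat \<Rightarrow> real" where
  "direction c = (case c of R \<Rightarrow> (\<lambda>_. 1) | V \<Rightarrow> (\<lambda>\<kappa>. if \<kappa> = 0 then 0 else 1)
     | T1 \<Rightarrow> (\<lambda>\<kappa>. if \<kappa> = 1 then 0 else 1) | T2 \<Rightarrow> (\<lambda>\<kappa>. if \<kappa> = 2 then 0 else 1)
     | L1 \<Rightarrow> (\<lambda>\<kappa>. if \<kappa> = 2 then 1 else 0) | L2 \<Rightarrow> (\<lambda>\<kappa>. if \<kappa> = 0 then 1 else 0)
     | L3 \<Rightarrow> (\<lambda>\<kappa>. if \<kappa> = 1 then 1 else 0))"

lemma direction_realises: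
  assumes "may_follow a c"
  shows "nonzero (direction c) \<and> letter_for (slots_after a) (direction c) = c"
  using assms
  by (cases a; cases c) (simp_all add: may_follow_def nonzero_def letter_for_def slots_after_def direction_def)

definition legal :: "letter list \<Rightarrow> bool" where
  "legal \<omega> \<longleftrightarrow> \<omega> ! 0 = R \<and> (\<forall>i. Suc i < length \<omega> \<longrightarrow> may_follow (\<omega> ! i) (\<omega> ! Suc i))"

lemma legal_snoc:
  assumes "\<omega> \<noteq> []"
  shows "legal (\<omega> @ [c]) \<longleftrightarrow> legal \<omega> \<and> may_follow (last \<omega>) c"
proof -
  have 1: "(\<omega> @ [c]) ! 0 = \<omega> ! 0" using assms by (simp add: nth_append)
  have 2: "(\<forall>i. Suc i < Suc (length \<omega>) \<longrightarrow> may_follow ((\<omega> @ [c]) ! i) ((\<omega> @ [c]) ! Suc i)) \<longleftrightarrow>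
    (\<forall>i. Suc i < length \<omega> \<longrightarrow> may_follow (\<omega> ! i) (\<omega> ! Suc i)) \<and> may_follow (last \<omega>) c" (is "?L \<longleftrightarrow> ?R")
  proof
    assume L: ?L
    show ?R
    proof (intro conjI allI impI)
      fix i assume "Suc i < length \<omega>"
      with L[rule_format, of i] show "may_follow (\<omega> ! i) (\<omega> ! Suc i)" by (simp add: nth_append)
    next
      show "may_follow (last \<omega>) c"
        using L[rule_format, of "length \<omega> - 1"] assms by (simp add: nth_append last_conv_nth)
    qed
  next
    assume R: ?R
    show ?L
    proof (intro allI impI)
      fix i assume "Suc i < Suc (length \<omega>)"
      then consider "Suc i < length \<omega>" | "Suc i = length \<omega>" by linarith
      then show "may_follow ((\<omega> @ [c]) ! i) ((\<omega> @ [c]) ! Suc i)"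
      proof cases
        case 2
        then have "i = length \<omega> - 1" "i < length \<omega>" by auto
        with R 2 assms show ?thesis by (simp add: nth_append last_conv_nth)
      qed (use R in \<open>simp add: nth_append\<close>)
    qed
  qed
  show ?thesis unfolding legal_def by (simp only: 1 2 length_append_singleton conj_assoc)
qed

lemma length_rvt_code [simp]: "length (rvt_code \<sigma> k p) = k"
  by (simp add: rvt_code_def)

lemma rvt_code_1:
  assumes "is_line l"
  shows "rvt_code \<sigma> (Suc 0) (point p l) = [letter_of (\<sigma> (point p l)) 0 p l]"
  by (simp add: rvt_code_def base_point[OF assms] line_point[OF assms])

lemma rvt_code_Suc:
  assumes l: "is_line l" and k: "1 \<le> k"
  shows "rvt_code \<sigma> (Suc k) (point p l) =
    rvt_code \<sigma> k p @ [letter_of (\<sigma> ((base ^^ (k - 1)) p)) k p l]"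
proof -
  have pow: "(base ^^ (Suc k - i)) (point p l) = (base ^^ (k - i)) p" if "i \<le> k" for i
    using that by (simp add: Suc_diff_le funpow_Suc_right base_point[OF l] del: funpow.simps(2))
  have one: "(base ^^ (Suc k - 1)) (point p l) = (base ^^ (k - 1)) p"
    using pow[of 1] k by simp
  have "[1..<Suc (Suc k)] = [1..<Suc k] @ [Suc k]" using k by simp
  then show ?thesis
    unfolding rvt_code_def one by (simp add: pow base_point[OF l] line_point[OF l] Let_def del: upt_Suc)
qed

lemma mem_M_Suc: "q \<in> M (Suc i) \<longleftrightarrow> (\<exists>p l. q = point p l \<and> p \<in> M i \<and> is_line l \<and> l \<subseteq> \<Delta> i p)"
  unfolding tower_Suc mem_prolong_iff ..

text \<open>
  By induction on the level, the last letter of the code determines the slots at the point, and these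
  bound the next letter.
\<close>

lemma coded_rvt_code:
  assumes adm: "\<And>q. q \<in> M 1 \<Longrightarrow> admissible (\<sigma> q) q" and p: "p \<in> M (Suc k)"
  shows "coded (\<sigma> ((base ^^ k) p)) (Suc k) p (slots_after (last (rvt_code \<sigma> (Suc k) p))) \<and>
    legal (rvt_code \<sigma> (Suc k) p)"
  using p
proof (induction k arbitrary: p)
  case 0
  then obtain q l where q: "p = point q l" "q \<in> R3" "is_line l" "l \<subseteq> \<Delta> 0 q"
    unfolding mem_M_Suc M_0 by blast
  have "\<sigma> p permutes {..<3}" using adm[of p] 0 by (simp add: admissible_def)
  from coded_line[OF coded_R3[OF this q(2)] q(3,4)] show ?case
    by (auto simp: q(1) rvt_code_1[OF q(3)] next_slots_level_0 legal_def)
next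
  case (Suc k)
  then obtain q l where q: "p = point q l" "q \<in> M (Suc k)" "is_line l" "l \<subseteq> \<Delta> (Suc k) q"
    unfolding mem_M_Suc[of p] by blast
  let ?s = "\<sigma> ((base ^^ k) q)" and ?w = "rvt_code \<sigma> (Suc k) q"
  from Suc.IH[OF q(2)] have IH: "coded ?s (Suc k) q (slots_after (last ?w))" "legal ?w" by auto
  from coded_line[OF IH(1) q(3,4)] obtain r where r: "nonzero r"
    "letter_of ?s (Suc k) q l = letter_for (slots_after (last ?w)) r"
    "coded ?s (Suc (Suc k)) p (next_slots (slots_after (last ?w)) r)" unfolding q(1) by blast
  have code: "rvt_code \<sigma> (Suc (Suc k)) p = ?w @ [letter_for (slots_after (last ?w)) r]"
    using rvt_code_Suc[OF q(3), of "Suc k" \<sigma> q] by (simp add: q(1) r(2))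
  have "(base ^^ Suc k) p = (base ^^ k) q"
    by (simp add: q(1) funpow_Suc_right base_point[OF q(3)] del: funpow.simps(2))
  moreover have "?w \<noteq> []" using length_rvt_code[of \<sigma> "Suc k" q] by fastforce
  then have "legal (rvt_code \<sigma> (Suc (Suc k)) p)"
    unfolding code using legal_snoc IH(2) letter_for_may_follow[OF r(1)] by blast
  ultimately show ?case
    using r(3) by (simp only: code last_snoc next_slots_eq[OF r(1)] simp_thms)
qed

text \<open>
  A point with the shorter word exists by induction, and the line given by \<open>direction\<close> realises the
  last letter over it.
\<close>

lemma legal_realised:
  assumes adm: "\<And>q. q \<in> M 1 \<Longrightarrow> admissible (\<sigma> q) q"
    and \<omega>: "length \<omega> = Suc k" "legal \<omega>"
  shows "\<exists>p\<in>M (Suc k). rvt_code \<sigma> (Suc k) p = \<omega>"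
  using \<omega>
proof (induction k arbitrary: \<omega>)
  case 0
  have "(0 :: ambient) \<in> R3" by (simp add: R3_def)
  from coded_direction[OF coded_R3[OF permutes_id this], of "\<lambda>_. 1"] obtain l
    where l: "is_line l" "l \<subseteq> \<Delta> 0 0" by (auto simp: nonzero_def)
  define p where "p = point 0 l"
  have p: "p \<in> M (Suc 0)" unfolding mem_M_Suc using l \<open>0 \<in> R3\<close> by (auto simp: p_def M_0)
  have "legal (rvt_code \<sigma> (Suc 0) p)" using coded_rvt_code[OF adm p] by blast
  with 0 have "rvt_code \<sigma> (Suc 0) p ! 0 = \<omega> ! 0" by (simp add: legal_def)
  with 0(1) have "rvt_code \<sigma> (Suc 0) p = \<omega>" by (intro nth_equalityI) auto
  with p show ?case by blast
next
  case (Suc k)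
  from Suc.prems(1) obtain \<omega>' c where w: "\<omega> = \<omega>' @ [c]" "length \<omega>' = Suc k"
    by (metis length_Suc_conv_rev)
  then have "\<omega>' \<noteq> []" by auto
  with Suc.prems(2) w have leg: "legal \<omega>'" "may_follow (last \<omega>') c" by (simp_all add: legal_snoc)
  from Suc.IH[OF w(2) leg(1)] obtain q where q: "q \<in> M (Suc k)" "rvt_code \<sigma> (Suc k) q = \<omega>'" by blast
  have "coded (\<sigma> ((base ^^ k) q)) (Suc k) q (slots_after (last \<omega>'))"
    using coded_rvt_code[OF adm q(1)] q(2) by simp
  note dir = direction_realises[OF leg(2)]
  from coded_direction[OF \<open>coded _ _ _ _\<close> conjunct1[OF dir]] obtain l where
    l: "is_line l" "l \<subseteq> \<Delta> (Suc k) q" "letter_of (\<sigma> ((base ^^ k) q)) (Suc k) q l = c"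
    using dir by auto
  have "rvt_code \<sigma> (Suc (Suc k)) (point q l) = \<omega>"
    using rvt_code_Suc[OF l(1), of "Suc k" \<sigma> q] by (simp add: q(2) l(3) w(1))
  moreover have "point q l \<in> M (Suc (Suc k))" unfolding mem_M_Suc[of _ "Suc k"] using q(1) l by blast
  ultimately show ?case by blast
qed

theorem theorem2:
  fixes k :: nat and \<omega> :: "letter list" and \<sigma> :: "ambient \<Rightarrow> nat \<Rightarrow> nat"
  assumes "1 \<le> k"
    and "length \<omega> = k"
    and "\<And>q. q \<in> M 1 \<Longrightarrow> admissible (\<sigma> q) q"
  shows "(\<exists>p\<in>M k. rvt_code \<sigma> k p = \<omega>) \<longleftrightarrow>
      \<omega> ! 0 = R \<and>
      (\<forall>i. Suc i < k \<longrightarrow>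
         (\<omega> ! i = R \<longrightarrow> \<omega> ! Suc i \<in> {R, V}) \<and>
         (\<omega> ! i \<in> {V, T1} \<longrightarrow> \<omega> ! Suc i \<in> {R, V, T1, L1}) \<and>
         (\<omega> ! i = T2 \<longrightarrow> \<omega> ! Suc i \<in> {R, V, T2, L3}) \<and>
         (\<omega> ! i \<in> {L1, L2, L3} \<longrightarrow> \<omega> ! Suc i \<in> UNIV))"
proof -
  obtain j where k: "k = Suc j" using assms(1) by (cases k) auto
  have "(\<exists>p\<in>M k. rvt_code \<sigma> k p = \<omega>) \<longleftrightarrow> legal \<omega>"
    using coded_rvt_code[OF assms(3)] legal_realised[OF assms(3)] assms(2) unfolding k by blast
  then show ?thesis by (simp only: legal_def may_follow_def assms(2))
qed

end
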